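(* Let $m\in\mathbb{N}$ be fixed, let $\mathcal{H}^S$ be an $m$-dimensional complex Hilbert space, and for each $n\in\mathbb{N}$ let $\mathcal{H}^E$ be an $n$-dimensional complex Hilbert space and $\mu_n$ the unitarily invariant probability measure on the unit vectors of $\mathcal{H}^S\otimes\mathcal{H}^E$. For a unit vector $|\Psi\rangle\in\mathcal{H}^S\otimes\mathcal{H}^E$ put $\rho_\Psi:=\mathrm{Tr}_E[|\Psi\rangle\langle\Psi|]$, and let $\pi:=I/m$ be the maximally mixed state on $\mathcal{H}^S$. Then for any subset $\Omega\subseteq\mathcal{S}(\mathcal{H}^S)$, $$-\limsup_{n\to\infty}\frac1n\ln \Pr\{\rho_\Psi\in\Omega\mid\Psi\sim\mu_n\}\;\ge\; m\inf_{\rho\in\mathrm{cl}\,\Omega}D(\pi\|\rho),$$ $$-\liminf_{n\to\infty}\frac1n\ln \Pr\{\rho_\Psi\in\Omega\mid\Psi\sim\mu_n\}\;\le\; m\inf_{\rho\in\mathrm{int}\,\Omega}D(\pi\|\rho).$$ In particular, for any subset $\Omega\subseteq\mathcal{S}(\mathcal{H}^S)$ satisfying $\mathrm{cl}(\mathrm{int}\,\Omega)=\mathrm{cl}\,\Omega$, $$-\lim_{n\to\infty}\frac1n\ln \Pr\{\rho_\Psi\in\Omega\mid\Psi\sim\mu_n\}= m\inf_{\rho\in\Omega}D(\pi\|\rho).$$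
   Context: $\mathcal{S}(\mathcal{H}^S)$ is the set of density operators (positive semidefinite, trace one) on $\mathcal{H}^S$, regarded as a metric space with the trace distance $\frac12\|\rho-\sigma\|_1$; closure $\mathrm{cl}$ and interior $\mathrm{int}$ are taken in this metric space. Subsets are understood to be such that the probabilities are defined (measurable). $D(\sigma\|\rho):=\mathrm{Tr}[\sigma\ln\sigma-\sigma\ln\rho]$ is the quantum relative entropy with natural logarithm; $D(\pi\|\rho)=+\infty$ if $\rho$ is not of full rank. Conventions: $\inf\emptyset=+\infty$, $\ln 0=-\infty$. The notation $\Psi\sim\mu_n$ means that $|\Psi\rangle$ is drawn according to $\mu_n$. *)

theory Defs
  imports "HOL-Probability.Probability"
begin

subsection \<open>Operators on the system space\<close>

text \<open>
  The $m$-dimensional space is \<^typ>\<open>complex^'m\<close> with $m = |{'m}|$, and its operators are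
  the matrices \<^typ>\<open>complex^'m^'m\<close>.
\<close>

definition dagger :: "complex^'m^'n \<Rightarrow> complex^'n^'m" where
  "dagger A = (\<chi> i j. cnj (A $ j $ i))"

definition unitary_mat :: "complex^'m^'m \<Rightarrow> bool" where
  "unitary_mat U \<longleftrightarrow> dagger U ** U = mat 1 \<and> U ** dagger U = mat 1"

definition real_diag :: "('m \<Rightarrow> real) \<Rightarrow> complex^'m^'m" where
  "real_diag d = (\<chi> i j. if i = j then complex_of_real (d i) else 0)"

text \<open>
  Functional calculus $f(A) = U\,\mathrm{diag}(f(d))\,U^\dagger$ for Hermitian
  $A = U\,\mathrm{diag}(d)\,U^\dagger$; unspecified if $A$ is not Hermitian.  The value does not
  depend on the diagonalisation, see \<open>matrix_fun_eq\<close> below.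
\<close>

definition matrix_fun :: "(real \<Rightarrow> real) \<Rightarrow> complex^'m^'m \<Rightarrow> complex^'m^'m" where
  "matrix_fun f A = (THE B. \<exists>U d. unitary_mat U \<and>
      A = U ** real_diag d ** dagger U \<and> B = U ** real_diag (f \<circ> d) ** dagger U)"

lemma matrix_fun_unique:
  fixes U V :: "complex^'m^'m"
  assumes U: "unitary_mat U" and V: "unitary_mat V"
    and eq: "U ** real_diag d ** dagger U = V ** real_diag e ** dagger V"
  shows "U ** real_diag (f \<circ> d) ** dagger U = V ** real_diag (f \<circ> e) ** dagger V"
proof -
  define W where "W = dagger V ** U"
  have entry: "(W ** real_diag a) $ i $ j = W $ i $ j * of_real (a j)"
    "(real_diag a ** W) $ i $ j = of_real (a i) * W $ i $ j" for a i j
    by (simp_all add: matrix_matrix_mult_def real_diag_def if_distrib if_distribR cong: if_cong)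
  have "W ** real_diag d = dagger V ** (U ** real_diag d ** dagger U) ** U"
    using U by (simp add: W_def unitary_mat_def matrix_mul_assoc[symmetric])
  also have "\<dots> = dagger V ** (V ** real_diag e ** dagger V) ** U"
    by (simp add: eq)
  also have "\<dots> = (dagger V ** V) ** real_diag e ** W"
    by (simp add: W_def matrix_mul_assoc)
  also have "\<dots> = real_diag e ** W"
    using V by (simp add: unitary_mat_def)
  finally have "W $ i $ j * of_real (d j) = of_real (e i) * W $ i $ j" for i j
    by (metis entry)
  then have "W $ i $ j = 0 \<or> d j = e i" for i j
    by (metis mult.commute mult_cancel_left of_real_eq_iff)
  then have "W $ i $ j * of_real (f (d j)) = of_real (f (e i)) * W $ i $ j" for i j
    by (metis mult.commute mult_zero_left)
  then have fW: "W ** real_diag (f \<circ> d) = real_diag (f \<circ> e) ** W"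
    by (simp add: vec_eq_iff entry)
  have "V ** (W ** real_diag (f \<circ> d)) ** dagger U
      = (V ** dagger V) ** (U ** real_diag (f \<circ> d) ** dagger U)"
    by (simp add: W_def matrix_mul_assoc)
  moreover have "V ** (real_diag (f \<circ> e) ** W) ** dagger U
      = V ** real_diag (f \<circ> e) ** dagger V ** (U ** dagger U)"
    by (simp add: W_def matrix_mul_assoc)
  ultimately show ?thesis
    using U V fW by (simp add: unitary_mat_def)
qed

lemma matrix_fun_eq:
  assumes "unitary_mat U"
  shows "matrix_fun f (U ** real_diag d ** dagger U) = U ** real_diag (f \<circ> d) ** dagger U"
  unfolding matrix_fun_def
proof (rule the_equality)
  fix B
  assume "\<exists>V e. unitary_mat V \<and> U ** real_diag d ** dagger U = V ** real_diag e ** dagger V \<and>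
    B = V ** real_diag (f \<circ> e) ** dagger V"
  then show "B = U ** real_diag (f \<circ> d) ** dagger U"
    using matrix_fun_unique[OF assms] by metis
qed (use assms in blast)

definition psd :: "complex^'m^'m \<Rightarrow> bool" where
  "psd A \<longleftrightarrow> (\<forall>v. (\<Sum>i\<in>UNIV. cnj (v $ i) * (A *v v) $ i) \<in> \<real>\<^sub>\<ge>\<^sub>0)"

definition density_ops :: "(complex^'m^'m) set" where
  "density_ops = {\<rho>. psd \<rho> \<and> trace \<rho> = 1}"

definition trace_norm :: "complex^'m^'m \<Rightarrow> real" where
  "trace_norm A = Re (trace (matrix_fun sqrt (dagger A ** A)))"

definition trace_dist :: "complex^'m^'m \<Rightarrow> complex^'m^'m \<Rightarrow> real" where
  "trace_dist \<rho> \<sigma> = trace_norm (\<rho> - \<sigma>) / 2"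

definition state_topology :: "(complex^'m^'m) topology" where
  "state_topology = Metric_space.mtopology density_ops trace_dist"

definition max_mixed :: "complex^'m^'m" where
  "max_mixed = mat 1 /\<^sub>R real CARD('m)"

text \<open>
  The relative entropy of states, $+\infty$ unless $\ker\rho \subseteq \ker\sigma$.  The library's
  \<^prop>\<open>ln (0::real) = 0\<close> implements the conventions $0 \ln 0 = 0$ and, on $\ker\rho$,
  that $\ln\rho$ is only taken on the support of $\rho$.
\<close>

definition rel_entropy :: "complex^'m^'m \<Rightarrow> complex^'m^'m \<Rightarrow> ereal" where
  "rel_entropy \<sigma> \<rho> =
    (if \<forall>v. \<rho> *v v = 0 \<longrightarrow> \<sigma> *v v = 0
     then ereal (Re (trace (\<sigma> ** matrix_fun ln \<sigma> - \<sigma> ** matrix_fun ln \<rho>)))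
     else \<infinity>)"

lemma rel_entropy_max_mixed_singular:
  assumes "\<not> invertible \<rho>"
  shows "rel_entropy max_mixed \<rho> = \<infinity>"
proof -
  obtain v where "\<rho> *v v = 0" "v \<noteq> 0"
    using assms by (metis invertible_left_inverse matrix_left_invertible_ker)
  moreover have "max_mixed *v v = v /\<^sub>R real CARD('a)"
    by (simp add: max_mixed_def vec_eq_iff matrix_vector_mult_def mat_def if_distrib if_distribR
        cong: if_cong)
  ultimately show ?thesis
    by (auto simp: rel_entropy_def)
qed

subsection \<open>Random pure states on a finite-dimensional space\<close>

text \<open>
  For a finite index set $I$ the space $\mathbf{C}^I$ is represented by the functions in
  \<^term>\<open>extensional I\<close>, and an operator on it by its matrix entries on $I \times I$.
  Joint states live on \<open>I = UNIV \<times> {..<n}\<close>, the tensor product of the system with an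
  $n$-dimensional environment.
\<close>

definition unit_vectors :: "'i set \<Rightarrow> ('i \<Rightarrow> complex) set" where
  "unit_vectors I = {\<psi> \<in> extensional I. (\<Sum>p\<in>I. (cmod (\<psi> p))\<^sup>2) = 1}"

definition sphere_algebra :: "'i set \<Rightarrow> ('i \<Rightarrow> complex) measure" where
  "sphere_algebra I = restrict_space (Pi\<^sub>M I (\<lambda>_. borel)) (unit_vectors I)"

definition unitary_on :: "'i set \<Rightarrow> ('i \<Rightarrow> 'i \<Rightarrow> complex) \<Rightarrow> bool" where
  "unitary_on I U \<longleftrightarrow>
    (\<forall>p\<in>I. \<forall>q\<in>I. (\<Sum>r\<in>I. cnj (U r p) * U r q) = (if p = q then 1 else 0)) \<and>
    (\<forall>p\<in>I. \<forall>q\<in>I. (\<Sum>r\<in>I. U p r * cnj (U q r)) = (if p = q then 1 else 0))"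

definition op_apply :: "'i set \<Rightarrow> ('i \<Rightarrow> 'i \<Rightarrow> complex) \<Rightarrow> ('i \<Rightarrow> complex) \<Rightarrow> ('i \<Rightarrow> complex)" where
  "op_apply I U \<psi> = (\<lambda>p\<in>I. \<Sum>q\<in>I. U p q * \<psi> q)"

definition unitarily_invariant_prob :: "'i set \<Rightarrow> ('i \<Rightarrow> complex) measure \<Rightarrow> bool" where
  "unitarily_invariant_prob I M \<longleftrightarrow>
    prob_space M \<and> sets M = sets (sphere_algebra I) \<and>
    (\<forall>U. unitary_on I U \<longrightarrow> distr M M (op_apply I U) = M)"

text \<open>
  \<^const>\<open>distr\<close> is meaningful in the last clause because unitaries act measurably on the
  unit sphere.
\<close>

lemma op_apply_unit_vectors:
  assumes "finite I" "unitary_on I U" "\<psi> \<in> unit_vectors I"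
  shows "op_apply I U \<psi> \<in> unit_vectors I"
proof -
  have sq: "complex_of_real (\<Sum>p\<in>I. (cmod (f p))\<^sup>2) = (\<Sum>p\<in>I. f p * cnj (f p))" for f :: "_ \<Rightarrow> complex"
    by (simp add: complex_norm_square del: of_real_power)
  have "complex_of_real (\<Sum>p\<in>I. (cmod (op_apply I U \<psi> p))\<^sup>2)
      = (\<Sum>r\<in>I. (\<Sum>q\<in>I. U r q * \<psi> q) * (\<Sum>p\<in>I. cnj (U r p) * cnj (\<psi> p)))"
    unfolding sq by (simp add: op_apply_def)
  also have "\<dots> = (\<Sum>r\<in>I. \<Sum>q\<in>I. \<Sum>p\<in>I. (cnj (U r p) * U r q) * (\<psi> q * cnj (\<psi> p)))"
    by (simp add: sum_product algebra_simps)
  also have "\<dots> = (\<Sum>q\<in>I. \<Sum>r\<in>I. \<Sum>p\<in>I. (cnj (U r p) * U r q) * (\<psi> q * cnj (\<psi> p)))"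
    by (rule sum.swap)
  also have "\<dots> = (\<Sum>q\<in>I. \<Sum>p\<in>I. \<Sum>r\<in>I. (cnj (U r p) * U r q) * (\<psi> q * cnj (\<psi> p)))"
    by (intro sum.cong refl sum.swap)
  also have "\<dots> = (\<Sum>q\<in>I. \<Sum>p\<in>I. (if p = q then 1 else 0) * (\<psi> q * cnj (\<psi> p)))"
    using assms(2) by (intro sum.cong refl) (simp add: unitary_on_def sum_distrib_right[symmetric])
  also have "\<dots> = (\<Sum>q\<in>I. \<psi> q * cnj (\<psi> q))"
    using assms(1) by (intro sum.cong refl) (simp add: if_distrib[of "\<lambda>x. x * _"] cong: if_cong)
  also have "\<dots> = 1"
    using assms(3) by (simp add: sq[symmetric] unit_vectors_def del: of_real_sum of_real_power)
  finally have "(\<Sum>p\<in>I. (cmod (op_apply I U \<psi> p))\<^sup>2) = 1"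
    by (metis of_real_eq_1_iff)
  then show ?thesis
    by (simp add: unit_vectors_def op_apply_def)
qed

lemma measurable_op_apply:
  assumes "finite I" "unitary_on I U"
  shows "op_apply I U \<in> measurable (sphere_algebra I) (sphere_algebra I)"
  unfolding sphere_algebra_def
proof (rule measurable_restrict_space3)
  show "op_apply I U \<in> measurable (Pi\<^sub>M I (\<lambda>_. borel)) (Pi\<^sub>M I (\<lambda>_. borel))"
    unfolding op_apply_def by measurable
qed (use op_apply_unit_vectors[OF assms] in auto)

subsection \<open>Reduced states\<close>

definition pure_op :: "('i \<Rightarrow> complex) \<Rightarrow> 'i \<Rightarrow> 'i \<Rightarrow> complex" where
  "pure_op \<psi> p q = \<psi> p * cnj (\<psi> q)"

definition partial_trace_env ::
    "nat \<Rightarrow> ('m \<times> nat \<Rightarrow> 'm \<times> nat \<Rightarrow> complex) \<Rightarrow> complex^'m^'m" where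
  "partial_trace_env n X = (\<chi> i j. \<Sum>k<n. X (i, k) (j, k))"

definition reduced_state :: "nat \<Rightarrow> ('m \<times> nat \<Rightarrow> complex) \<Rightarrow> complex^'m^'m" where
  "reduced_state n \<psi> = partial_trace_env n (pure_op \<psi>)"

subsection \<open>Logarithm of a probability\<close>

definition eln :: "real \<Rightarrow> ereal" where
  "eln p = (if p = 0 then -\<infinity> else ereal (ln p))"

definition log_rate :: "(nat \<Rightarrow> ('m \<times> nat \<Rightarrow> complex) measure) \<Rightarrow> (complex^'m^'m) set \<Rightarrow> nat \<Rightarrow> ereal" where
  "log_rate \<mu> \<Omega> n = ereal (1 / real n) * eln (measure (\<mu> n) {\<psi> \<in> space (\<mu> n). reduced_state n \<psi> \<in> \<Omega>})"

end

theory Submission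
  imports Defs
begin

text \<open>
  Any unitarily invariant probability measure on the unit sphere of a finite-dimensional Hilbert
  space gives open sets the measure of the cones over them inside the ball, under Lebesgue measure.
  For a positive matrix $A$ on the system, the linear map $A \otimes 1$ multiplies Lebesgue measure by
  $(\det A)^{2n}$ and sends cones to cones; hence, if $\mathrm{Tr}[A \rho A] \le t$ for all $\rho \in N$
  and $\rho \mapsto A \rho A / \mathrm{Tr}[A \rho A]$ maps $N$ into $G$, then
  $\Pr(N)\, (\det A)^{2n} \le t^{mn} \Pr(G)$.

  Taking for $G$ all states and $A^2 = (\rho_0 + \delta)^{-1}$, $t = m + \delta$, one bounds the
  probability of a neighbourhood of $\rho_0$ by roughly $(m^m \det \rho_0)^n = e^{-n m D(\pi \| \rho_0)}$,
  whether or not $\rho_0$ is singular.  Compactness of the state space turns this into the upper bound.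
  Since $m^m \det \rho < 1$ for $\rho \ne \pi$ by AM-GM, the reduced state concentrates at $\pi$; taking
  for $N$ a neighbourhood of $\pi$ and $A^2 = m \rho_0$ then gives the lower bound near $\rho_0$.
\<close>

subsection \<open>Lebesgue measure on a finite power of the complex plane\<close>

text \<open>The law of the reduced state has a density on the state space only if n is at least m.
  Cones in the joint space avoid that density and treat all n alike. Lebesgue measure is only ever
  rescaled coordinate by coordinate: matrices on the system are diagonalised first, and the
  unitaries that diagonalise them are absorbed by the invariance of the probability measure. The
  factor \<open>(det A)^(2n)\<close> counts each eigenvalue twice, for the two real dimensions of a
  complex coordinate, and once for each environment index; \<open>t^(mn)\<close> comes from
  shrinking by \<open>sqrt t\<close> in real dimension 2mn. The probability measures are known only
  through their invariance, so volume estimates must be transferred to them from an explicit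
  invariant measure. The transfer is made for open sets. This is enough, because each estimate
  concerns an open set of states that contains the event in question or whose states all belong to
  it.\<close>

abbreviation lborel_pow :: "'i set \<Rightarrow> ('i \<Rightarrow> complex) measure" where
  "lborel_pow I \<equiv> Pi\<^sub>M I (\<lambda>_. lborel)"

definition norm_sq :: "'i set \<Rightarrow> ('i \<Rightarrow> complex) \<Rightarrow> real" where
  "norm_sq I x = (\<Sum>p\<in>I. (cmod (x p))\<^sup>2)"

definition vadd :: "'i set \<Rightarrow> ('i \<Rightarrow> complex) \<Rightarrow> ('i \<Rightarrow> complex) \<Rightarrow> 'i \<Rightarrow> complex" where
  "vadd I x y = (\<lambda>p\<in>I. x p + y p)"

definition scale_coords :: "'i set \<Rightarrow> ('i \<Rightarrow> real) \<Rightarrow> ('i \<Rightarrow> complex) \<Rightarrow> 'i \<Rightarrow> complex" where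
  "scale_coords I a x = (\<lambda>p\<in>I. a p *\<^sub>R x p)"

interpretation lborel_prod: product_sigma_finite "\<lambda>_::'i. lborel :: complex measure"
  by standard

lemma norm_sq_measurable [measurable]: "norm_sq I \<in> borel_measurable (lborel_pow I)"
  unfolding norm_sq_def by measurable

lemma norm_sq_nonneg [simp]: "0 \<le> norm_sq I x"
  by (simp add: norm_sq_def sum_nonneg)

lemma measurable_scale_coords [measurable]:
  "scale_coords I a \<in> measurable (lborel_pow I) (lborel_pow I)"
  unfolding scale_coords_def by measurable

lemma measurable_vadd [measurable]:
  "(\<lambda>(x, y). vadd I x y) \<in> measurable (lborel_pow I \<Otimes>\<^sub>M lborel_pow I) (lborel_pow I)"
  unfolding vadd_def by measurable

lemma measurable_vadd_right [measurable]: "vadd I t \<in> measurable (lborel_pow I) (lborel_pow I)"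
  unfolding vadd_def by measurable

lemma measurable_op_apply_lborel [measurable]:
  "op_apply I U \<in> measurable (lborel_pow I) (lborel_pow I)"
  unfolding op_apply_def by measurable

lemma emeasure_lborel_affine:
  fixes t :: "'a::euclidean_space"
  assumes "A \<in> sets borel" "a > 0"
  shows "ennreal (a ^ DIM('a)) * emeasure lborel ((\<lambda>x. t + a *\<^sub>R x) -` A) = emeasure lborel A"
proof -
  have "emeasure lborel A = emeasure (density (distr lborel borel (\<lambda>x. t + a *\<^sub>R x)) (\<lambda>_. \<bar>a\<bar> ^ DIM('a))) A"
    using lborel_affine[of a t] assms(2) by simp
  also have "\<dots> = ennreal (a ^ DIM('a)) * emeasure lborel ((\<lambda>x. t + a *\<^sub>R x) -` A)"
    using assms by (simp add: emeasure_density_const emeasure_distr)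
  finally show ?thesis by simp
qed

text \<open>Both measures need only be compared on boxes, and a coordinatewise affine map pulls
  boxes back to boxes. Each complex coordinate has real dimension 2, whence the squares. Dilations
  (t = 0) and translations (a = 1) are the two cases used.\<close>

lemma lborel_pow_affine:
  assumes I: "finite I" and a: "\<And>p. p \<in> I \<Longrightarrow> a p > 0"
  shows "scale_measure (ennreal (\<Prod>p\<in>I. (a p)\<^sup>2)) (distr (lborel_pow I) (lborel_pow I) (\<lambda>x. vadd I t (scale_coords I a x)))
    = lborel_pow I"
proof (rule lborel_prod.PiM_eqI[OF I])
  let ?f = "\<lambda>x. vadd I t (scale_coords I a x)"
  have f[measurable]: "?f \<in> measurable (lborel_pow I) (lborel_pow I)"
    by measurable
  fix A :: "'a \<Rightarrow> complex set" assume A: "\<And>i. i \<in> I \<Longrightarrow> A i \<in> sets lborel"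
  have "?f -` Pi\<^sub>E I A \<inter> space (lborel_pow I) = Pi\<^sub>E I (\<lambda>p. (\<lambda>z. t p + a p *\<^sub>R z) -` A p)"
    by (auto simp: space_PiM vadd_def scale_coords_def PiE_def Pi_def)
  moreover have "(\<lambda>z. t p + a p *\<^sub>R z) -` A p \<in> sets borel" if "p \<in> I" for p
    using measurable_sets[of "\<lambda>z. t p + a p *\<^sub>R z" borel borel "A p"] A[OF that] by simp
  ultimately have "emeasure (distr (lborel_pow I) (lborel_pow I) ?f) (Pi\<^sub>E I A)
      = (\<Prod>p\<in>I. emeasure lborel ((\<lambda>z. t p + a p *\<^sub>R z) -` A p))"
    using I A by (subst emeasure_distr[OF f]) (auto intro!: sets_PiM_I_finite lborel_prod.emeasure_PiM)
  then have "emeasure (scale_measure (ennreal (\<Prod>p\<in>I. (a p)\<^sup>2)) (distr (lborel_pow I) (lborel_pow I) ?f)) (Pi\<^sub>E I A)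
      = (\<Prod>p\<in>I. ennreal ((a p)\<^sup>2) * emeasure lborel ((\<lambda>z. t p + a p *\<^sub>R z) -` A p))"
    by (simp add: prod.distrib prod_ennreal)
  also have "\<dots> = (\<Prod>p\<in>I. emeasure lborel (A p))"
  proof (rule prod.cong[OF refl])
    fix p assume "p \<in> I"
    then show "ennreal ((a p)\<^sup>2) * emeasure lborel ((\<lambda>z. t p + a p *\<^sub>R z) -` A p) = emeasure lborel (A p)"
      using emeasure_lborel_affine[of "A p" "a p" "t p"] A a by simp
  qed
  finally show "emeasure (scale_measure (ennreal (\<Prod>p\<in>I. (a p)\<^sup>2)) (distr (lborel_pow I) (lborel_pow I) ?f)) (Pi\<^sub>E I A)
      = (\<Prod>i\<in>I. emeasure lborel (A i))" .
qed simp

lemma emeasure_scale_coords: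
  assumes I: "finite I" and a: "\<And>p. p \<in> I \<Longrightarrow> a p > 0" and S: "S \<in> sets (lborel_pow I)"
  shows "ennreal (\<Prod>p\<in>I. (a p)\<^sup>2) * emeasure (lborel_pow I) (scale_coords I a -` S \<inter> space (lborel_pow I))
    = emeasure (lborel_pow I) S"
proof -
  have eq: "vadd I (\<lambda>_. 0) (scale_coords I a x) = scale_coords I a x" for x
    by (auto simp: vadd_def scale_coords_def)
  have "scale_measure (ennreal (\<Prod>p\<in>I. (a p)\<^sup>2)) (distr (lborel_pow I) (lborel_pow I) (scale_coords I a)) = lborel_pow I"
    using lborel_pow_affine[OF I, where a=a and t="\<lambda>_. 0"] a by (simp add: eq)
  from arg_cong[OF this, where f="\<lambda>M. emeasure M S"] show ?thesis
    using S by (simp add: emeasure_distr)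
qed

lemma nn_integral_translate:
  assumes I: "finite I" and f[measurable]: "f \<in> borel_measurable (lborel_pow I)"
  shows "(\<integral>\<^sup>+x. f (vadd I t x) \<partial>lborel_pow I) = (\<integral>\<^sup>+x. f x \<partial>lborel_pow I)"
proof -
  have eq: "vadd I t (scale_coords I (\<lambda>_. 1) x) = vadd I t x" for x
    by (auto simp: vadd_def scale_coords_def)
  have "distr (lborel_pow I) (lborel_pow I) (vadd I t) = lborel_pow I"
    using lborel_pow_affine[OF I, where a="\<lambda>_. 1" and t=t] by (simp add: eq scale_measure_1)
  then have "(\<integral>\<^sup>+x. f x \<partial>lborel_pow I) = (\<integral>\<^sup>+x. f x \<partial>distr (lborel_pow I) (lborel_pow I) (vadd I t))"
    by simp
  then show ?thesis
    by (simp add: nn_integral_distr)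
qed

lemma sets_lborel_pow [measurable_cong]: "sets (lborel_pow I) = sets (Pi\<^sub>M I (\<lambda>_. borel))"
  by (rule sets_PiM_cong) simp_all

lemma space_lborel_pow [simp]: "space (lborel_pow I) = extensional I"
  by (simp add: space_PiM PiE_def)

lemma measurable_vadd' [measurable (raw)]:
  assumes "f \<in> measurable M (lborel_pow I)" "g \<in> measurable M (lborel_pow I)"
  shows "(\<lambda>z. vadd I (f z) (g z)) \<in> measurable M (lborel_pow I)"
  using measurable_compose[OF measurable_Pair[OF assms] measurable_vadd] by simp

section \<open>Unitaries and their adjoints on the coordinate space\<close>

definition adjoint_op :: "('i \<Rightarrow> 'i \<Rightarrow> complex) \<Rightarrow> 'i \<Rightarrow> 'i \<Rightarrow> complex" where
  "adjoint_op U p q = cnj (U q p)"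

definition vneg :: "'i set \<Rightarrow> ('i \<Rightarrow> complex) \<Rightarrow> 'i \<Rightarrow> complex" where
  "vneg I x = (\<lambda>p\<in>I. - x p)"

lemma measurable_vneg [measurable]: "vneg I \<in> measurable (lborel_pow I) (lborel_pow I)"
  unfolding vneg_def by measurable

lemma norm_sq_vneg [simp]: "norm_sq I (vneg I x) = norm_sq I x"
  by (simp add: norm_sq_def vneg_def)

lemma unitary_on_adjoint: "unitary_on I U \<Longrightarrow> unitary_on I (adjoint_op U)"
  by (simp add: unitary_on_def adjoint_op_def mult.commute)

lemma of_real_norm_sq: "complex_of_real (norm_sq I x) = (\<Sum>p\<in>I. x p * cnj (x p))"
  by (simp add: norm_sq_def complex_norm_square del: of_real_power)

lemma op_apply_adjoint:
  assumes I: "finite I" and U: "unitary_on I U" and x: "x \<in> extensional I"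
  shows "op_apply I (adjoint_op U) (op_apply I U x) = x"
proof
  fix p
  show "op_apply I (adjoint_op U) (op_apply I U x) p = x p"
  proof (cases "p \<in> I")
    case True
    have "op_apply I (adjoint_op U) (op_apply I U x) p = (\<Sum>q\<in>I. \<Sum>r\<in>I. cnj (U q p) * U q r * x r)"
      using True by (simp add: op_apply_def adjoint_op_def sum_distrib_left mult.assoc)
    also have "\<dots> = (\<Sum>r\<in>I. (\<Sum>q\<in>I. cnj (U q p) * U q r) * x r)"
      by (subst sum.swap) (simp add: sum_distrib_right)
    also have "\<dots> = (\<Sum>r\<in>I. (if p = r then 1 else 0) * x r)"
      using U True by (intro sum.cong refl) (simp add: unitary_on_def)
    also have "\<dots> = x p"
      using I True by (simp add: if_distrib[of "\<lambda>x. x * _"] cong: if_cong)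
    finally show ?thesis .
  qed (use x in \<open>simp add: op_apply_def extensional_def\<close>)
qed

lemma op_apply_adjoint':
  assumes "finite I" "unitary_on I U" "x \<in> extensional I"
  shows "op_apply I U (op_apply I (adjoint_op U) x) = x"
proof -
  have "adjoint_op (adjoint_op U) = U" by (simp add: adjoint_op_def fun_eq_iff)
  then show ?thesis using op_apply_adjoint[OF assms(1) unitary_on_adjoint[OF assms(2)] assms(3)] by simp
qed

lemma norm_sq_op_apply:
  assumes I: "finite I" and U: "unitary_on I U"
  shows "norm_sq I (op_apply I U x) = norm_sq I x"
proof -
  \<comment> \<open>Inverting \<open>U\<close> by its adjoint returns an extensional vector, so x is
    first cut down to I; neither the norm nor the image depends on x outside I.\<close>
  define y where "y = restrict x I"
  have y: "y \<in> extensional I" "norm_sq I y = norm_sq I x" "op_apply I U x = op_apply I U y"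
    by (auto simp: y_def norm_sq_def op_apply_def intro!: sum.cong restrict_ext)
  have "complex_of_real (norm_sq I (op_apply I U y)) = (\<Sum>p\<in>I. op_apply I U y p * (\<Sum>q\<in>I. cnj (U p q) * cnj (y q)))"
    by (simp add: of_real_norm_sq op_apply_def)
  also have "\<dots> = (\<Sum>q\<in>I. (\<Sum>p\<in>I. cnj (U p q) * op_apply I U y p) * cnj (y q))"
    by (simp add: sum_distrib_left sum_distrib_right, subst sum.swap) (simp add: mult_ac)
  also have "\<dots> = (\<Sum>q\<in>I. op_apply I (adjoint_op U) (op_apply I U y) q * cnj (y q))"
    by (intro sum.cong refl) (simp add: op_apply_def[of I "adjoint_op U"] adjoint_op_def)
  also have "\<dots> = of_real (norm_sq I y)"
    by (simp add: op_apply_adjoint[OF I U y(1)] of_real_norm_sq)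
  finally show ?thesis using y by (metis of_real_eq_iff)
qed

lemma op_apply_vadd: "op_apply I U (vadd I x y) = vadd I (op_apply I U x) (op_apply I U y)"
  by (auto simp: op_apply_def vadd_def algebra_simps sum.distrib intro!: restrict_ext)

text \<open>The origin is left out so that normalisation maps every point to the unit sphere. The
  set is unitarily invariant with finite positive volume, which also makes it the test set for the
  invariance of Lebesgue measure.\<close>

definition punctured_ball :: "'i set \<Rightarrow> ('i \<Rightarrow> complex) set" where
  "punctured_ball I = {x \<in> extensional I. 0 < norm_sq I x \<and> norm_sq I x \<le> 1}"

lemma sets_punctured_ball [measurable]: "punctured_ball I \<in> sets (lborel_pow I)"
proof -
  have "{x \<in> space (lborel_pow I). 0 < norm_sq I x \<and> norm_sq I x \<le> 1} \<in> sets (lborel_pow I)"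
    by measurable
  then show ?thesis by (simp add: punctured_ball_def)
qed

lemma emeasure_punctured_ball_finite:
  assumes I: "finite I" shows "emeasure (lborel_pow I) (punctured_ball I) < \<infinity>"
proof -
  have "cmod (x p) \<le> 1" if "p \<in> I" "norm_sq I x \<le> 1" for p x
  proof -
    have "(cmod (x p))\<^sup>2 \<le> norm_sq I x" unfolding norm_sq_def
      using that I by (intro member_le_sum) auto
    then have "(cmod (x p))\<^sup>2 \<le> 1\<^sup>2" using that by simp
    then show ?thesis by (rule power2_le_imp_le) simp
  qed
  then have "punctured_ball I \<subseteq> Pi\<^sub>E I (\<lambda>_. cball 0 1)"
    by (auto simp: punctured_ball_def PiE_def Pi_def)
  then have "emeasure (lborel_pow I) (punctured_ball I) \<le> emeasure (lborel_pow I) (Pi\<^sub>E I (\<lambda>_. cball 0 1))"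
    using I by (intro emeasure_mono sets_PiM_I_finite) auto
  also have "\<dots> = (\<Prod>p\<in>I. emeasure lborel (cball (0::complex) 1))"
    using I by (intro lborel_prod.emeasure_PiM) auto
  also have "\<dots> < \<infinity>"
    using emeasure_lborel_cball_finite[of "0::complex" 1] by (simp add: power_less_top_ennreal)
  finally show ?thesis .
qed

lemma emeasure_punctured_ball_pos:
  assumes I: "finite I" "I \<noteq> {}" shows "emeasure (lborel_pow I) (punctured_ball I) > 0"
proof -
  \<comment> \<open>The polydisc of discs with centre r and radius r avoids zero coordinates, and
    its coordinates have modulus at most 2r, so \<open>norm_sq\<close> is at most card I * (2r)^2 =
    1 / card I.\<close>
  define r where "r = 1 / (2 * real (card I))"
  have card: "card I > 0" using I by (simp add: card_gt_0_iff)
  then have r: "r > 0" by (simp add: r_def)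
  have "Pi\<^sub>E I (\<lambda>_. ball (complex_of_real r) r) \<subseteq> punctured_ball I"
  proof
    fix x assume x: "x \<in> Pi\<^sub>E I (\<lambda>_. ball (complex_of_real r) r)"
    have p: "x p \<noteq> 0" "cmod (x p) \<le> 2 * r" if "p \<in> I" for p
    proof -
      have d: "cmod (of_real r - x p) < r" using x that by (auto simp: dist_norm)
      then show "x p \<noteq> 0" using r by auto
      have "cmod (x p) \<le> cmod (of_real r) + cmod (of_real r - x p)"
        by (metis norm_minus_commute norm_triangle_sub)
      then show "cmod (x p) \<le> 2 * r" using d r by simp
    qed
    have "norm_sq I x \<le> (\<Sum>p\<in>I. (2 * r)\<^sup>2)" unfolding norm_sq_def
      by (intro sum_mono power_mono p) auto
    also have "\<dots> = 1 / real (card I)" using card by (simp add: r_def power2_eq_square)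
    also have "\<dots> \<le> 1" using card by simp
    finally have "norm_sq I x \<le> 1" .
    moreover have "0 < norm_sq I x" unfolding norm_sq_def
      using I p by (intro sum_pos) auto
    ultimately show "x \<in> punctured_ball I" using x by (auto simp: punctured_ball_def PiE_def)
  qed
  then have "emeasure (lborel_pow I) (Pi\<^sub>E I (\<lambda>_. ball (complex_of_real r) r)) \<le> emeasure (lborel_pow I) (punctured_ball I)"
    by (intro emeasure_mono) auto
  moreover have "emeasure (lborel_pow I) (Pi\<^sub>E I (\<lambda>_. ball (complex_of_real r) r)) = (\<Prod>p\<in>I. emeasure lborel (ball (complex_of_real r) r))"
    using I by (intro lborel_prod.emeasure_PiM) auto
  moreover have "emeasure lborel (ball (complex_of_real r) r) > 0"
    using r by (simp add: emeasure_ball unit_ball_vol_pos)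
  ultimately have "emeasure (lborel_pow I) (punctured_ball I) \<noteq> 0"
    by (auto simp: I)
  then show ?thesis
    by (simp add: zero_less_iff_neq_zero)
qed

text \<open>
  Translation invariance characterizes the measure up to a constant: with $B$ the punctured ball,
  $\int\!\int 1_A(Uy)\, 1_B(x - Uy)$ is evaluated in both orders of integration, substituting
  $y \mapsto y + U^* x$ in one of them.
\<close>

lemma emeasure_op_apply:
  assumes I: "finite I" "I \<noteq> {}" and U: "unitary_on I U" and A[measurable]: "A \<in> sets (lborel_pow I)"
  shows "emeasure (lborel_pow I) (op_apply I U -` A \<inter> extensional I) = emeasure (lborel_pow I) A"
proof -
  let ?L = "lborel_pow I" and ?U = "op_apply I U" and ?V = "op_apply I (adjoint_op U)"
  let ?B = "punctured_ball I"
  interpret L: finite_product_sigma_finite "\<lambda>_. lborel :: complex measure" I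
    by standard (rule I(1))
  interpret sigma_finite_measure ?L by (rule L.sigma_finite_measure_axioms)
  interpret pair_sigma_finite ?L ?L by standard
  have invB: "?U x \<in> ?B \<longleftrightarrow> x \<in> ?B" if "x \<in> extensional I" for x
    using that by (simp add: punctured_ball_def norm_sq_op_apply[OF I(1) U]) (simp add: op_apply_def)
  have "emeasure ?L (?U -` A \<inter> extensional I) * emeasure ?L ?B
      = (\<integral>\<^sup>+y. indicator A (?U y) * emeasure ?L ?B \<partial>?L)"
  proof -
    have "?U -` A \<inter> space ?L \<in> sets ?L" by measurable
    then have "emeasure ?L (?U -` A \<inter> extensional I) = (\<integral>\<^sup>+y. indicator (?U -` A \<inter> extensional I) y \<partial>?L)"
      by simp
    also have "\<dots> = (\<integral>\<^sup>+y. indicator A (?U y) \<partial>?L)"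
      by (intro nn_integral_cong) (auto simp: indicator_def)
    finally show ?thesis by (simp add: nn_integral_multc)
  qed
  also have "\<dots> = (\<integral>\<^sup>+y. \<integral>\<^sup>+x. indicator A (?U y) * indicator ?B (vadd I (vneg I (?U y)) x) \<partial>?L \<partial>?L)"
  proof (rule nn_integral_cong)
    fix y
    have "emeasure ?L ?B = (\<integral>\<^sup>+x. indicator ?B (vadd I (vneg I (?U y)) x) \<partial>?L)"
      by (subst nn_integral_translate[OF I(1)]) auto
    then show "indicator A (?U y) * emeasure ?L ?B
        = (\<integral>\<^sup>+x. indicator A (?U y) * indicator ?B (vadd I (vneg I (?U y)) x) \<partial>?L)"
      by (simp add: nn_integral_cmult)
  qed
  also have "\<dots> = (\<integral>\<^sup>+x. \<integral>\<^sup>+y. indicator A (?U y) * indicator ?B (vadd I (vneg I (?U y)) x) \<partial>?L \<partial>?L)"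
    by (intro Fubini') measurable
  also have "\<dots> = (\<integral>\<^sup>+x. \<integral>\<^sup>+y. indicator A (vadd I (?U y) x) * indicator ?B y \<partial>?L \<partial>?L)"
  proof (rule nn_integral_cong)
    fix x assume x: "x \<in> space ?L"
    then have Vx: "?U (?V x) = x" using op_apply_adjoint'[OF I(1) U] by simp
    have "(\<integral>\<^sup>+y. indicator A (?U y) * indicator ?B (vadd I (vneg I (?U y)) x) \<partial>?L)
        = (\<integral>\<^sup>+y. indicator A (?U (vadd I (?V x) y)) * indicator ?B (vadd I (vneg I (?U (vadd I (?V x) y))) x) \<partial>?L)"
      using x by (subst nn_integral_translate[OF I(1), symmetric, where t="?V x"]) auto
    also have "\<dots> = (\<integral>\<^sup>+y. indicator A (vadd I (?U y) x) * indicator ?B y \<partial>?L)"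
    proof (rule nn_integral_cong)
      fix y assume y: "y \<in> space ?L"
      have e1: "?U (vadd I (?V x) y) = vadd I (?U y) x"
        by (auto simp: op_apply_vadd Vx) (auto simp: vadd_def)
      have e2: "vadd I (vneg I (?U (vadd I (?V x) y))) x = vneg I (?U y)"
        unfolding e1 by (auto simp: vadd_def vneg_def)
      \<comment> \<open>The ball is invariant under \<open>U\<close> and under negation, so after
        the substitution its indicator no longer involves x.\<close>
      have "vneg I (?U y) \<in> ?B \<longleftrightarrow> y \<in> ?B"
        using invB[of y] y by (auto simp: punctured_ball_def) (auto simp: vneg_def op_apply_def)
      then show "(indicator A (?U (vadd I (?V x) y)) * indicator ?B (vadd I (vneg I (?U (vadd I (?V x) y))) x) :: ennreal)
          = indicator A (vadd I (?U y) x) * indicator ?B y"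
        unfolding e2 unfolding e1 by (simp add: indicator_def)
    qed
    finally show "(\<integral>\<^sup>+y. indicator A (?U y) * indicator ?B (vadd I (vneg I (?U y)) x) \<partial>?L)
        = (\<integral>\<^sup>+y. indicator A (vadd I (?U y) x) * indicator ?B y \<partial>?L)" .
  qed
  also have "\<dots> = (\<integral>\<^sup>+y. \<integral>\<^sup>+x. indicator A (vadd I (?U y) x) * indicator ?B y \<partial>?L \<partial>?L)"
    by (intro Fubini') measurable
  also have "\<dots> = (\<integral>\<^sup>+y. emeasure ?L A * indicator ?B y \<partial>?L)"
  proof (rule nn_integral_cong)
    fix y
    have "(\<integral>\<^sup>+x. indicator A (vadd I (?U y) x) * indicator ?B y \<partial>?L)
        = (\<integral>\<^sup>+x. indicator A (vadd I (?U y) x) \<partial>?L) * indicator ?B y"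
      by (simp add: nn_integral_multc)
    also have "(\<integral>\<^sup>+x. indicator A (vadd I (?U y) x) \<partial>?L) = emeasure ?L A"
      by (subst nn_integral_translate[OF I(1)]) auto
    finally show "(\<integral>\<^sup>+x. indicator A (vadd I (?U y) x) * indicator ?B y \<partial>?L) = emeasure ?L A * indicator ?B y" .
  qed
  also have "\<dots> = emeasure ?L A * emeasure ?L ?B"
    by (simp add: nn_integral_cmult)
  finally show ?thesis
    using emeasure_punctured_ball_finite[OF I(1)] emeasure_punctured_ball_pos[OF I]
    by (metis ennreal_mult_divide_eq infinity_ennreal_def less_irrefl)
qed

subsection \<open>Uniqueness of the invariant measure on open sets\<close>

lemma space_sphere_algebra [simp]: "space (sphere_algebra I) = unit_vectors I"
proof -
  have "unit_vectors I \<inter> extensional I = unit_vectors I"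
    unfolding unit_vectors_def by blast
  then show ?thesis
    unfolding sphere_algebra_def space_restrict_space space_PiM by (simp add: PiE_def)
qed

lemma mem_unit_vectors: "\<psi> \<in> unit_vectors I \<longleftrightarrow> \<psi> \<in> extensional I \<and> norm_sq I \<psi> = 1"
  by (simp add: unit_vectors_def norm_sq_def)

lemma sphere_component:
  "p \<in> I \<Longrightarrow> (\<lambda>\<psi>. \<psi> p) \<in> measurable (sphere_algebra I) borel"
  unfolding sphere_algebra_def by (intro measurable_restrict_space1) measurable

text \<open>The square root is omitted: the caps built from this quantity rely on symmetry, unitary
  invariance, measurability and openness, not on a triangle inequality.\<close>

definition dist_sq :: "'i set \<Rightarrow> ('i \<Rightarrow> complex) \<Rightarrow> ('i \<Rightarrow> complex) \<Rightarrow> real" where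
  "dist_sq I x y = (\<Sum>p\<in>I. (cmod (x p - y p))\<^sup>2)"

lemma dist_sq_commute: "dist_sq I x y = dist_sq I y x"
  by (simp add: dist_sq_def norm_minus_commute)

lemma dist_sq_measurable [measurable (raw)]:
  assumes "f \<in> measurable M (sphere_algebra I)" "g \<in> measurable M (sphere_algebra I)"
  shows "(\<lambda>z. dist_sq I (f z) (g z)) \<in> borel_measurable M"
proof -
  have "(\<lambda>z. f z p) \<in> borel_measurable M" "(\<lambda>z. g z p) \<in> borel_measurable M" if "p \<in> I" for p
    using measurable_compose[OF assms(1) sphere_component[OF that]]
      measurable_compose[OF assms(2) sphere_component[OF that]] by blast+
  then have "(\<lambda>z. f z p - g z p) \<in> borel_measurable M" if "p \<in> I" for p
    using that by (intro borel_measurable_diff) auto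
  then have "(\<lambda>z. cmod (f z p - g z p)) \<in> borel_measurable M" if "p \<in> I" for p
    using measurable_compose[OF _ borel_measurable_norm] that by blast
  then show ?thesis unfolding dist_sq_def
    by (intro borel_measurable_sum borel_measurable_power)
qed

lemma dist_sq_op_apply:
  assumes "finite I" "unitary_on I U"
  shows "dist_sq I (op_apply I U x) (op_apply I U y) = dist_sq I x y"
proof -
  have "dist_sq I (op_apply I U x) (op_apply I U y) = norm_sq I (op_apply I U (\<lambda>p. x p - y p))"
    by (simp add: dist_sq_def norm_sq_def op_apply_def sum_subtractf right_diff_distrib)
  then show ?thesis
    by (simp add: norm_sq_op_apply[OF assms]) (simp add: dist_sq_def norm_sq_def)
qed

text \<open>
  The unitary is $1 - w w^* / \alpha$ with $w = x - x'$ and $\alpha = w^* x$; it is the identity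
  (division by zero) if $x = x'$.  Unitarity amounts to $|w|^2 = \alpha + \bar\alpha$.
\<close>

lemma unitary_on_transitive:
  assumes I: "finite I" and x: "x \<in> unit_vectors I" and x': "x' \<in> unit_vectors I"
  obtains U where "unitary_on I U" "op_apply I U x = x'"
proof -
  define w where "w p = x p - x' p" for p
  define \<alpha> where "\<alpha> = (\<Sum>p\<in>I. cnj (w p) * x p)"
  define U where "U p q = (if p = q then 1 else 0) - w p * cnj (w q) / \<alpha>" for p q
  define W where "W = (\<Sum>p\<in>I. w p * cnj (w p))"
  have xx: "(\<Sum>p\<in>I. x p * cnj (x p)) = 1" "(\<Sum>p\<in>I. x' p * cnj (x' p)) = 1"
    using x x' by (simp_all add: mem_unit_vectors of_real_norm_sq[symmetric])
  have W: "W = \<alpha> + cnj \<alpha>"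
  proof -
    have "W = (\<Sum>p\<in>I. x p * cnj (x p)) + (\<Sum>p\<in>I. x' p * cnj (x' p))
        - (\<Sum>p\<in>I. cnj (x' p) * x p) - (\<Sum>p\<in>I. x' p * cnj (x p))"
      unfolding W_def w_def by (simp add: algebra_simps sum.distrib sum_subtractf)
    moreover have "\<alpha> = (\<Sum>p\<in>I. x p * cnj (x p)) - (\<Sum>p\<in>I. cnj (x' p) * x p)"
      unfolding \<alpha>_def w_def by (simp add: algebra_simps sum.distrib sum_subtractf)
    moreover have "cnj \<alpha> = (\<Sum>p\<in>I. x p * cnj (x p)) - (\<Sum>p\<in>I. x' p * cnj (x p))"
      unfolding \<alpha>_def w_def by (simp add: algebra_simps sum.distrib sum_subtractf)
    ultimately show ?thesis using xx by simp
  qed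
  have key: "1 / \<alpha> + 1 / cnj \<alpha> - W / (\<alpha> * cnj \<alpha>) = 0"
    by (cases "\<alpha> = 0") (simp_all add: W field_simps)
  have e1: "(\<Sum>r\<in>I. cnj (U r p) * U r q) = (if p = q then 1 else 0)" if "p \<in> I" "q \<in> I" for p q
  proof -
    have "(\<Sum>r\<in>I. cnj (U r p) * U r q)
        = (\<Sum>r\<in>I. (if r = p then (if p = q then 1 else 0) else 0) - (if r = p then w p * cnj (w q) / \<alpha> else 0)
            - (if r = q then w p * cnj (w q) / cnj \<alpha> else 0) + w p * cnj (w q) / (\<alpha> * cnj \<alpha>) * (w r * cnj (w r)))"
      unfolding U_def by (intro sum.cong refl) (auto simp: algebra_simps)
    also have "\<dots> = (if p = q then 1 else 0) - w p * cnj (w q) / \<alpha> - w p * cnj (w q) / cnj \<alpha> + w p * cnj (w q) / (\<alpha> * cnj \<alpha>) * W"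
      using I that by (simp add: sum.distrib sum_subtractf W_def sum_distrib_left sum_divide_distrib)
    also have "\<dots> = (if p = q then 1 else 0) - w p * cnj (w q) * (1 / \<alpha> + 1 / cnj \<alpha> - W / (\<alpha> * cnj \<alpha>))"
      by (simp add: algebra_simps)
    finally show ?thesis by (simp only: key) simp
  qed
  have e2: "(\<Sum>r\<in>I. U p r * cnj (U q r)) = (if p = q then 1 else 0)" if "p \<in> I" "q \<in> I" for p q
  proof -
    have "(\<Sum>r\<in>I. U p r * cnj (U q r))
        = (\<Sum>r\<in>I. (if r = p then (if p = q then 1 else 0) else 0) - (if r = p then w p * cnj (w q) / cnj \<alpha> else 0)
            - (if r = q then w p * cnj (w q) / \<alpha> else 0) + w p * cnj (w q) / (\<alpha> * cnj \<alpha>) * (w r * cnj (w r)))"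
      unfolding U_def by (intro sum.cong refl) (auto simp: algebra_simps)
    also have "\<dots> = (if p = q then 1 else 0) - w p * cnj (w q) / cnj \<alpha> - w p * cnj (w q) / \<alpha> + w p * cnj (w q) / (\<alpha> * cnj \<alpha>) * W"
      using I that by (simp add: sum.distrib sum_subtractf W_def sum_distrib_left sum_divide_distrib)
    also have "\<dots> = (if p = q then 1 else 0) - w p * cnj (w q) * (1 / \<alpha> + 1 / cnj \<alpha> - W / (\<alpha> * cnj \<alpha>))"
      by (simp add: algebra_simps)
    finally show ?thesis by (simp only: key) simp
  qed
  have "op_apply I U x = x'"
  proof
    fix p
    show "op_apply I U x p = x' p"
    proof (cases "p \<in> I")
      case True
      have "op_apply I U x p = (\<Sum>q\<in>I. (if p = q then x p else 0) - w p / \<alpha> * (cnj (w q) * x q))"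
        using True unfolding op_apply_def by (auto simp: U_def algebra_simps intro!: sum.cong)
      also have "\<dots> = x p - w p / \<alpha> * \<alpha>"
        using True I by (simp add: sum_subtractf sum_distrib_left[symmetric] \<alpha>_def[symmetric] del: times_divide_eq_left)
      also have "\<dots> = x' p"
      proof (cases "\<alpha> = 0")
        case True
        \<comment> \<open>If \<open>\<alpha>\<close> vanishes, so does
          \<open>W = \<alpha> + cnj \<alpha>\<close>; hence x and x' agree on I and the default
          value of division does no harm.\<close>
        then have "norm_sq I w = 0"
          using W unfolding W_def of_real_norm_sq[symmetric] by simp
        then have "w p = 0"
          using I \<open>p \<in> I\<close> by (simp add: norm_sq_def sum_nonneg_eq_0_iff)
        then show ?thesis by (simp add: w_def)
      qed (simp add: w_def)
      finally show ?thesis .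
    qed (use x' in \<open>auto simp: op_apply_def mem_unit_vectors extensional_def\<close>)
  qed
  moreover have "unitary_on I U"
    using e1 e2 by (simp add: unitary_on_def)
  ultimately show ?thesis using that by blast
qed

section \<open>Caps and their measure under invariant probabilities\<close>

definition sphere_cap :: "'i set \<Rightarrow> ('i \<Rightarrow> complex) \<Rightarrow> real \<Rightarrow> ('i \<Rightarrow> complex) set" where
  "sphere_cap I x r = {y \<in> unit_vectors I. dist_sq I x y < r}"

lemma sets_sphere_cap [measurable]:
  assumes "x \<in> unit_vectors I" shows "sphere_cap I x r \<in> sets (sphere_algebra I)"
proof -
  have "(\<lambda>y. dist_sq I x y) \<in> borel_measurable (sphere_algebra I)"
    using assms by (intro dist_sq_measurable measurable_const measurable_ident_sets refl) simp
  from borel_measurable_less[OF this borel_measurable_const] show ?thesis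
    unfolding sphere_cap_def space_sphere_algebra .
qed

lemma unitarily_invariant_probD:
  assumes "unitarily_invariant_prob I M"
  shows "prob_space M" "sets M = sets (sphere_algebra I)" "space M = unit_vectors I"
    "unitary_on I U \<Longrightarrow> distr M M (op_apply I U) = M"
  using assms sets_eq_imp_space_eq[of M "sphere_algebra I"] by (auto simp: unitarily_invariant_prob_def)

lemma emeasure_op_apply_vimage:
  assumes M: "unitarily_invariant_prob I M" and "finite I" "unitary_on I U" "S \<in> sets M"
  shows "emeasure M (op_apply I U -` S \<inter> unit_vectors I) = emeasure M S"
proof -
  note D = unitarily_invariant_probD[OF M]
  have "op_apply I U \<in> measurable M M"
    using measurable_op_apply[OF assms(2,3)] measurable_cong_sets[OF D(2) D(2)] by blast
  then show ?thesis
    using emeasure_distr[of "op_apply I U" M M S] D assms by simp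
qed

text \<open>A unitary taking x to x' pulls the cap at x' back to the cap at x.\<close>

lemma emeasure_sphere_cap_const:
  assumes M: "unitarily_invariant_prob I M" and I: "finite I" and x: "x \<in> unit_vectors I" and x': "x' \<in> unit_vectors I"
  shows "emeasure M (sphere_cap I x r) = emeasure M (sphere_cap I x' r)"
proof -
  obtain U where U: "unitary_on I U" "op_apply I U x = x'"
    using unitary_on_transitive[OF I x x'] .
  have "op_apply I U -` sphere_cap I x' r \<inter> unit_vectors I = sphere_cap I x r"
    using dist_sq_op_apply[OF I U(1)] op_apply_unit_vectors[OF I U(1)]
    by (auto simp: sphere_cap_def U(2)[symmetric])
  then show ?thesis
    using emeasure_op_apply_vimage[OF M I U(1), of "sphere_cap I x' r"] x' unitarily_invariant_probD(2)[OF M]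
    by simp
qed

text \<open>Integrate the indicator of \<open>dist_sq I z y < r\<close> over both variables. By
  \<open>emeasure_sphere_cap_const\<close> each inner integral is constant, so one order of
  integration yields the cap measure under N and the other the cap measure under M.\<close>

lemma emeasure_sphere_cap_unique:
  assumes M: "unitarily_invariant_prob I M" and N: "unitarily_invariant_prob I N"
    and I: "finite I" and x: "x \<in> unit_vectors I"
  shows "emeasure M (sphere_cap I x r) = emeasure N (sphere_cap I x r)"
proof -
  note MD = unitarily_invariant_probD[OF M]
  note ND = unitarily_invariant_probD[OF N]
  interpret M: prob_space M by (rule MD)
  interpret N: prob_space N by (rule ND)
  interpret pair_prob_space M N ..
  note [measurable_cong] = MD(2) ND(2)
  have M': "(\<integral>\<^sup>+y. indicator {..<r} (dist_sq I y z) \<partial>M) = emeasure M (sphere_cap I x r)"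
    if z: "z \<in> unit_vectors I" for z
  proof -
    have "(\<integral>\<^sup>+y. indicator {..<r} (dist_sq I y z) \<partial>M) = (\<integral>\<^sup>+y. indicator (sphere_cap I z r) y \<partial>M)"
      by (intro nn_integral_cong) (auto simp: sphere_cap_def MD dist_sq_commute indicator_def)
    also have "\<dots> = emeasure M (sphere_cap I z r)"
      using z MD(2) by simp
    finally show ?thesis using emeasure_sphere_cap_const[OF M I z x] by simp
  qed
  have N': "(\<integral>\<^sup>+y. indicator {..<r} (dist_sq I z y) \<partial>N) = emeasure N (sphere_cap I x r)"
    if z: "z \<in> unit_vectors I" for z
  proof -
    have "(\<integral>\<^sup>+y. indicator {..<r} (dist_sq I z y) \<partial>N) = (\<integral>\<^sup>+y. indicator (sphere_cap I z r) y \<partial>N)"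
      by (intro nn_integral_cong) (auto simp: sphere_cap_def ND indicator_def)
    also have "\<dots> = emeasure N (sphere_cap I z r)"
      using z ND(2) by simp
    finally show ?thesis using emeasure_sphere_cap_const[OF N I z x] by simp
  qed
  have "emeasure N (sphere_cap I x r) = (\<integral>\<^sup>+z. \<integral>\<^sup>+y. indicator {..<r} (dist_sq I z y) \<partial>N \<partial>M)"
    using N' by (subst nn_integral_cong[where v="\<lambda>_. emeasure N (sphere_cap I x r)"])
      (auto simp: MD M.emeasure_space_1[unfolded MD(3)])
  also have "\<dots> = (\<integral>\<^sup>+y. \<integral>\<^sup>+z. indicator {..<r} (dist_sq I z y) \<partial>M \<partial>N)"
    by (rule Fubini'[symmetric]) measurable
  also have "\<dots> = emeasure M (sphere_cap I x r)"
    using M' by (subst nn_integral_cong[where v="\<lambda>_. emeasure M (sphere_cap I x r)"])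
      (auto simp: ND N.emeasure_space_1[unfolded ND(3)])
  finally show ?thesis by simp
qed

lemma open_dist_sq: "open {y :: 'i::countable \<Rightarrow> complex. dist_sq I x y < r}"
  unfolding dist_sq_def
  by (intro open_Collect_less continuous_intros continuous_on_product_coordinates)

text \<open>If one cap of radius r were null, all of them would be, and countably many of them cover
  the sphere by the Lindelof property. Countability of the index type provides this property for the
  function space.\<close>

lemma emeasure_sphere_cap_pos:
  fixes I :: "'i::countable set"
  assumes M: "unitarily_invariant_prob I M" and I: "finite I" and x: "x \<in> unit_vectors I" and r: "r > 0"
  shows "emeasure M (sphere_cap I x r) > 0"
proof (rule ccontr)
  assume "\<not> ?thesis"
  then have null: "emeasure M (sphere_cap I z r) = 0" if "z \<in> unit_vectors I" for z
    using emeasure_sphere_cap_const[OF M I x that, of r] by (simp add: zero_less_iff_neq_zero)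
  note MD = unitarily_invariant_probD[OF M]
  interpret M: prob_space M by (rule MD)
  let ?O = "\<lambda>x. {y :: 'i \<Rightarrow> complex. dist_sq I x y < r}"
  have open_caps: "open B" if "B \<in> ?O ` unit_vectors I" for B
    using that open_dist_sq by blast
  obtain F where F: "F \<subseteq> ?O ` unit_vectors I" "countable F" "\<Union>F = \<Union>(?O ` unit_vectors I)"
    by (rule Lindelof[OF open_caps])
  have "(\<Union>B\<in>F. B \<inter> unit_vectors I) \<in> null_sets M"
  proof (rule null_sets_UN'[OF F(2)])
    fix B assume "B \<in> F"
    then obtain z where z: "z \<in> unit_vectors I" "B = ?O z" using F(1) by auto
    then have "B \<inter> unit_vectors I = sphere_cap I z r" by (auto simp: sphere_cap_def)
    then show "B \<inter> unit_vectors I \<in> null_sets M"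
      using null[OF z(1)] sets_sphere_cap[OF z(1)] MD(2) by (simp add: null_sets_def)
  qed
  moreover have "unit_vectors I \<subseteq> (\<Union>B\<in>F. B \<inter> unit_vectors I)"
  proof
    fix z assume z: "z \<in> unit_vectors I"
    then have "z \<in> \<Union>(?O ` unit_vectors I)" using r by (auto simp: dist_sq_def intro!: bexI[of _ z])
    then show "z \<in> (\<Union>B\<in>F. B \<inter> unit_vectors I)" using z unfolding F(3)[symmetric] by auto
  qed
  then have "(\<Union>B\<in>F. B \<inter> unit_vectors I) = space M" using MD(3) by auto
  ultimately show False using M.emeasure_space_1 by (simp add: null_sets_def)
qed

text \<open>
  Christensen's argument for the uniqueness of uniformly distributed measures: for small $r$ the
  cap of radius $r$ at $x \in S$ lies in $S$, so Fatou's lemma bounds the measure of $S$ under $M$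
  by the double integral of $1_S(x)\, 1_S(y)\, 1_{d(x,y) < r}$ divided by the cap measure.
\<close>

lemma emeasure_sphere_open_le:
  fixes I :: "'i::countable set"
  assumes M: "unitarily_invariant_prob I M" and N: "unitarily_invariant_prob I N" and I: "finite I"
    and S: "S \<in> sets (sphere_algebra I)"
    and S_open: "\<And>x. x \<in> S \<Longrightarrow> \<exists>r>0. sphere_cap I x r \<subseteq> S"
  shows "emeasure M S \<le> emeasure N S"
proof (cases "S = {}")
  case False
  then obtain x0 where "x0 \<in> S" by auto
  then have x0: "x0 \<in> unit_vectors I" using sets.sets_into_space[OF S] by auto
  note MD = unitarily_invariant_probD[OF M]
  note ND = unitarily_invariant_probD[OF N]
  interpret M: prob_space M by (rule MD)
  interpret N: prob_space N by (rule ND)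
  interpret pair_prob_space M N ..
  note [measurable_cong] = MD(2) ND(2)
  note [measurable] = S
  define \<epsilon> where "\<epsilon> k = 1 / real (Suc k)" for k
  define c where "c k = emeasure N (sphere_cap I x0 (\<epsilon> k))" for k
  have c: "c k > 0" "c k < top" for k
    using emeasure_sphere_cap_pos[OF N I x0, of "\<epsilon> k"] N.emeasure_finite
    by (auto simp: c_def \<epsilon>_def top.not_eq_extremum[symmetric])
  define u where "u k x = (\<integral>\<^sup>+y. indicator S x * indicator S y * indicator {..<\<epsilon> k} (dist_sq I x y) \<partial>N) / c k" for k x
  have [measurable]: "u k \<in> borel_measurable M" for k
    unfolding u_def by measurable
  have "emeasure M S = (\<integral>\<^sup>+x. indicator S x \<partial>M)" using S MD(2) by simp
  also have "\<dots> \<le> (\<integral>\<^sup>+x. liminf (\<lambda>k. u k x) \<partial>M)"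
  proof (rule nn_integral_mono)
    fix x
    show "indicator S x \<le> liminf (\<lambda>k. u k x)"
    proof (cases "x \<in> S")
      case True
      then have x: "x \<in> unit_vectors I" using sets.sets_into_space[OF S] by auto
      obtain r where r: "r > 0" "sphere_cap I x r \<subseteq> S" using S_open[OF True] by auto
      have "eventually (\<lambda>k. \<epsilon> k < r) sequentially"
        using order_tendstoD(2)[OF LIMSEQ_inverse_real_of_nat r(1)] by (simp add: \<epsilon>_def inverse_eq_divide)
      then have "eventually (\<lambda>k. 1 \<le> u k x) sequentially"
      proof eventually_elim
        case (elim k)
        have "(\<integral>\<^sup>+y. indicator S x * indicator S y * indicator {..<\<epsilon> k} (dist_sq I x y) \<partial>N)
            = (\<integral>\<^sup>+y. indicator (sphere_cap I x (\<epsilon> k)) y \<partial>N)"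
          using r(2) True elim by (intro nn_integral_cong) (auto simp: sphere_cap_def indicator_def ND)
        also have "\<dots> = c k"
          using x ND(2) emeasure_sphere_cap_const[OF N I x x0] by (simp add: c_def)
        finally show ?case using c[of k] by (simp add: u_def ennreal_divide_self)
      qed
      then have "1 \<le> liminf (\<lambda>k. u k x)" by (rule Liminf_bounded)
      then show ?thesis by (simp add: True)
    qed simp
  qed
  also have "\<dots> \<le> liminf (\<lambda>k. \<integral>\<^sup>+x. u k x \<partial>M)"
    by (rule nn_integral_liminf) measurable
  also have "\<dots> \<le> liminf (\<lambda>k. emeasure N S)"
  proof (intro Liminf_mono always_eventually allI)
    fix k
    have "(\<integral>\<^sup>+x. u k x \<partial>M)
        = (\<integral>\<^sup>+x. \<integral>\<^sup>+y. indicator S x * indicator S y * indicator {..<\<epsilon> k} (dist_sq I x y) \<partial>N \<partial>M) / c k"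
      unfolding u_def by (rule nn_integral_divide) measurable
    also have "(\<integral>\<^sup>+x. \<integral>\<^sup>+y. indicator S x * indicator S y * indicator {..<\<epsilon> k} (dist_sq I x y) \<partial>N \<partial>M)
        = (\<integral>\<^sup>+y. \<integral>\<^sup>+x. indicator S x * indicator S y * indicator {..<\<epsilon> k} (dist_sq I x y) \<partial>M \<partial>N)"
      by (rule Fubini'[symmetric]) measurable
    also have "\<dots> \<le> (\<integral>\<^sup>+y. c k * indicator S y \<partial>N)"
    proof (rule nn_integral_mono)
      fix y assume "y \<in> space N"
      then have y: "y \<in> unit_vectors I" by (simp add: ND)
      have "(\<integral>\<^sup>+x. indicator S x * indicator S y * indicator {..<\<epsilon> k} (dist_sq I x y) \<partial>M)
          \<le> (\<integral>\<^sup>+x. indicator (sphere_cap I y (\<epsilon> k)) x * indicator S y \<partial>M)"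
        by (intro nn_integral_mono) (auto simp: sphere_cap_def indicator_def MD dist_sq_commute)
      also have "\<dots> = emeasure M (sphere_cap I y (\<epsilon> k)) * indicator S y"
        using y MD(2) by (simp add: nn_integral_multc)
      also have "emeasure M (sphere_cap I y (\<epsilon> k)) = c k"
        using emeasure_sphere_cap_unique[OF M N I y] emeasure_sphere_cap_const[OF N I y x0] by (simp add: c_def)
      finally show "(\<integral>\<^sup>+x. indicator S x * indicator S y * indicator {..<\<epsilon> k} (dist_sq I x y) \<partial>M) \<le> c k * indicator S y" .
    qed
    also have "\<dots> = c k * emeasure N S"
      using ND(2) S by (simp add: nn_integral_cmult)
    finally have "(\<integral>\<^sup>+x. u k x \<partial>M) \<le> c k * emeasure N S / c k"
      by (simp add: divide_right_mono_ennreal)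
    also have "\<dots> = emeasure N S"
      using c[of k] by (metis ennreal_mult_divide_eq less_irrefl mult.commute)
    finally show "(\<integral>\<^sup>+x. u k x \<partial>M) \<le> emeasure N S" .
  qed
  also have "\<dots> = emeasure N S" by (simp add: Liminf_const)
  finally show ?thesis .
qed simp

corollary emeasure_sphere_open_unique:
  fixes I :: "'i::countable set"
  assumes "unitarily_invariant_prob I M" "unitarily_invariant_prob I N" "finite I" "S \<in> sets (sphere_algebra I)"
    "\<And>x. x \<in> S \<Longrightarrow> \<exists>r>0. sphere_cap I x r \<subseteq> S"
  shows "emeasure M S = emeasure N S"
  using emeasure_sphere_open_le[OF assms(1,2)] emeasure_sphere_open_le[OF assms(2,1)] assms(3-)
  by (intro antisym) blast+

subsection \<open>The uniform measure on the sphere\<close>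

definition vnormalize :: "'i set \<Rightarrow> ('i \<Rightarrow> complex) \<Rightarrow> 'i \<Rightarrow> complex" where
  "vnormalize I x = (\<lambda>p\<in>I. x p /\<^sub>R sqrt (norm_sq I x))"

text \<open>An explicit invariant probability under which the measure of an event is a normalised
  cone volume. By \<open>emeasure_sphere_open_unique\<close> it agrees on open events with any given
  invariant measure.\<close>

definition uniform_sphere :: "'i set \<Rightarrow> ('i \<Rightarrow> complex) measure" where
  "uniform_sphere I = scale_measure (inverse (emeasure (lborel_pow I) (punctured_ball I)))
    (distr (restrict_space (lborel_pow I) (punctured_ball I)) (sphere_algebra I) (vnormalize I))"

lemma norm_sq_scale: "(\<And>p. p \<in> I \<Longrightarrow> y p = c *\<^sub>R x p) \<Longrightarrow> norm_sq I y = c\<^sup>2 * norm_sq I x"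
  by (simp add: norm_sq_def power_mult_distrib sum_distrib_left)

lemma vnormalize_unit:
  assumes "0 < norm_sq I x" shows "vnormalize I x \<in> unit_vectors I"
  using norm_sq_scale[of I "vnormalize I x" "inverse (sqrt (norm_sq I x))" x] assms
  by (simp add: mem_unit_vectors vnormalize_def power_inverse)

lemma vnormalize_scale:
  assumes "c > 0" "\<And>p. p \<in> I \<Longrightarrow> y p = c *\<^sub>R x p" shows "vnormalize I y = vnormalize I x"
proof -
  have "sqrt (norm_sq I y) = c * sqrt (norm_sq I x)"
    using norm_sq_scale[of I y c x] assms by (simp add: real_sqrt_mult)
  then show ?thesis using assms by (auto simp: vnormalize_def intro!: restrict_ext)
qed

lemma measurable_vnormalize:
  "vnormalize I \<in> measurable (restrict_space (lborel_pow I) (punctured_ball I)) (sphere_algebra I)"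
  unfolding sphere_algebra_def
proof (rule measurable_restrict_space3)
  have "(\<lambda>x. x p /\<^sub>R sqrt (norm_sq I x)) \<in> borel_measurable (lborel_pow I)" if "p \<in> I" for p
    using that by measurable
  then show "vnormalize I \<in> measurable (lborel_pow I) (Pi\<^sub>M I (\<lambda>_. borel))"
    unfolding vnormalize_def by (intro measurable_restrict)
  show "vnormalize I \<in> punctured_ball I \<rightarrow> unit_vectors I"
    using vnormalize_unit by (auto simp: punctured_ball_def)
qed

lemma punctured_ball_Int_space [simp]: "punctured_ball I \<inter> extensional I = punctured_ball I"
  by (auto simp: punctured_ball_def)

lemma sets_cone:
  assumes "S \<in> sets (sphere_algebra I)"
  shows "vnormalize I -` S \<inter> punctured_ball I \<in> sets (lborel_pow I)"
proof -
  have "vnormalize I -` S \<inter> punctured_ball I \<in> sets (restrict_space (lborel_pow I) (punctured_ball I))"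
    using measurable_sets[OF measurable_vnormalize assms] by (simp add: space_restrict_space)
  then show ?thesis
    using sets_restrict_space_iff[of "punctured_ball I" "lborel_pow I"] sets_punctured_ball[of I] by simp
qed

lemma emeasure_uniform_sphere:
  assumes "S \<in> sets (sphere_algebra I)"
  shows "emeasure (uniform_sphere I) S
    = inverse (emeasure (lborel_pow I) (punctured_ball I)) * emeasure (lborel_pow I) (vnormalize I -` S \<inter> punctured_ball I)"
  unfolding uniform_sphere_def using assms sets_punctured_ball[of I]
  by (simp add: emeasure_distr[OF measurable_vnormalize] space_restrict_space emeasure_restrict_space)

lemma vnormalize_op_apply:
  assumes "finite I" "unitary_on I U"
  shows "vnormalize I (op_apply I U x) = op_apply I U (vnormalize I x)"
  unfolding vnormalize_def norm_sq_op_apply[OF assms]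
  by (auto simp: op_apply_def scaleR_sum_right intro!: restrict_ext sum.cong)

text \<open>Normalisation commutes with unitaries, so the cone over a preimage is the preimage of
  the cone, and \<open>emeasure_op_apply\<close> says that both have the same volume.\<close>

lemma unitarily_invariant_uniform_sphere:
  assumes I: "finite I" "I \<noteq> {}"
  shows "unitarily_invariant_prob I (uniform_sphere I)"
  unfolding unitarily_invariant_prob_def
proof (intro conjI allI impI)
  let ?L = "lborel_pow I" and ?B = "punctured_ball I"
  show sets: "sets (uniform_sphere I) = sets (sphere_algebra I)"
    by (simp add: uniform_sphere_def)
  have space: "space (uniform_sphere I) = unit_vectors I"
    using sets_eq_imp_space_eq[OF sets] by simp
  have "vnormalize I -` unit_vectors I \<inter> ?B = ?B"
    using vnormalize_unit by (auto simp: punctured_ball_def)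
  then have "emeasure (uniform_sphere I) (unit_vectors I) = inverse (emeasure ?L ?B) * emeasure ?L ?B"
    by (subst emeasure_uniform_sphere) (simp_all del: space_sphere_algebra add: space_sphere_algebra[symmetric])
  also have "\<dots> = emeasure ?L ?B / emeasure ?L ?B"
    by (simp add: divide_ennreal_def mult.commute)
  also have "\<dots> = 1"
    using emeasure_punctured_ball_finite[OF I(1)] emeasure_punctured_ball_pos[OF I]
    by (intro ennreal_divide_self) auto
  finally show "prob_space (uniform_sphere I)"
    by (intro prob_spaceI) (simp add: space)
  fix U assume U: "unitary_on I U"
  have meas: "op_apply I U \<in> measurable (uniform_sphere I) (uniform_sphere I)"
    using measurable_op_apply[OF I(1) U] measurable_cong_sets[OF sets sets] by blast
  show "distr (uniform_sphere I) (uniform_sphere I) (op_apply I U) = uniform_sphere I"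
  proof (rule measure_eqI)
    fix S assume "S \<in> sets (distr (uniform_sphere I) (uniform_sphere I) (op_apply I U))"
    then have S: "S \<in> sets (sphere_algebra I)" by (simp add: sets)
    have US: "op_apply I U -` S \<inter> unit_vectors I \<in> sets (sphere_algebra I)"
      using measurable_sets[OF measurable_op_apply[OF I(1) U] S] by simp
    have "vnormalize I -` (op_apply I U -` S \<inter> unit_vectors I) \<inter> ?B
        = op_apply I U -` (vnormalize I -` S \<inter> ?B) \<inter> extensional I"
      using vnormalize_unit
      by (auto simp: punctured_ball_def vnormalize_op_apply[OF I(1) U] norm_sq_op_apply[OF I(1) U])
        (simp add: op_apply_def)
    then have "emeasure (uniform_sphere I) (op_apply I U -` S \<inter> unit_vectors I) = emeasure (uniform_sphere I) S"
      using emeasure_op_apply[OF I U sets_cone[OF S]]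
      by (simp add: emeasure_uniform_sphere[OF S] emeasure_uniform_sphere[OF US])
    then show "emeasure (distr (uniform_sphere I) (uniform_sphere I) (op_apply I U)) S = emeasure (uniform_sphere I) S"
      using S by (simp add: emeasure_distr[OF meas] sets space)
  qed simp
qed

text \<open>The dilation takes the cone over N into the cone over S, except that points may leave
  the unit ball. Their squared norm grows at most by the factor t, so dividing by
  \<open>sqrt t\<close> brings them back, without affecting their normalisation.\<close>

lemma uniform_sphere_scale:
  assumes I: "finite I" "I \<noteq> {}" and N: "N \<in> sets (sphere_algebra I)" and S: "S \<in> sets (sphere_algebra I)"
    and a: "\<And>p. p \<in> I \<Longrightarrow> a p > 0" and t: "t > 0"
    and norm_le: "\<And>\<psi>. \<psi> \<in> N \<Longrightarrow> norm_sq I (scale_coords I a \<psi>) \<le> t"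
    and image: "\<And>\<psi>. \<psi> \<in> N \<Longrightarrow> vnormalize I (scale_coords I a \<psi>) \<in> S"
  shows "measure (uniform_sphere I) N * (\<Prod>p\<in>I. (a p)\<^sup>2) \<le> t ^ card I * measure (uniform_sphere I) S"
proof -
  let ?L = "lborel_pow I" and ?B = "punctured_ball I"
  define b where "b p = a p / sqrt t" for p
  have b: "b p > 0" if "p \<in> I" for p using a[OF that] t by (simp add: b_def)
  have sub: "vnormalize I -` N \<inter> ?B \<subseteq> scale_coords I b -` (vnormalize I -` S \<inter> ?B) \<inter> space ?L"
  proof
    fix x assume "x \<in> vnormalize I -` N \<inter> ?B"
    then have x: "x \<in> extensional I" "0 < norm_sq I x" "norm_sq I x \<le> 1" and xN: "vnormalize I x \<in> N"
      by (auto simp: punctured_ball_def)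
    let ?\<psi> = "vnormalize I x" and ?s = "sqrt (norm_sq I x)"
    have eq: "scale_coords I b x p = (?s / sqrt t) *\<^sub>R scale_coords I a ?\<psi> p" if "p \<in> I" for p
      using that x(2) t by (simp add: scale_coords_def vnormalize_def b_def)
    have "norm_sq I (scale_coords I b x) = norm_sq I x / t * norm_sq I (scale_coords I a ?\<psi>)"
      using norm_sq_scale[OF eq] x t by (simp add: power_divide)
    also have "\<dots> \<le> norm_sq I x / t * t"
      using x t norm_le[OF xN] by (intro mult_left_mono) auto
    also have "\<dots> \<le> 1" using t x by simp
    finally have le: "norm_sq I (scale_coords I b x) \<le> 1" .
    have "\<exists>p\<in>I. x p \<noteq> 0"
    proof (rule ccontr)
      assume "\<not> ?thesis"
      then have "norm_sq I x = 0" by (simp add: norm_sq_def)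
      then show False using x(2) by simp
    qed
    then obtain p where p: "p \<in> I" "x p \<noteq> 0" by blast
    have "(cmod (scale_coords I b x p))\<^sup>2 \<le> norm_sq I (scale_coords I b x)"
      unfolding norm_sq_def using p I by (intro member_le_sum) auto
    moreover have "(cmod (scale_coords I b x p))\<^sup>2 > 0"
      using p b[OF p(1)] by (simp add: scale_coords_def)
    ultimately have pos: "0 < norm_sq I (scale_coords I b x)" by linarith
    have "vnormalize I (scale_coords I b x) = vnormalize I (scale_coords I a ?\<psi>)"
      using x t by (intro vnormalize_scale[OF _ eq]) auto
    then have "vnormalize I (scale_coords I b x) \<in> S" using image[OF xN] by simp
    moreover have "scale_coords I b x \<in> ?B"
      using pos le by (simp add: punctured_ball_def) (simp add: scale_coords_def)
    ultimately show "x \<in> scale_coords I b -` (vnormalize I -` S \<inter> ?B) \<inter> space ?L"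
      using x by simp
  qed
  interpret prob_space "uniform_sphere I"
    using unitarily_invariant_uniform_sphere[OF I] by (simp add: unitarily_invariant_prob_def)
  let ?P = "ennreal (\<Prod>p\<in>I. (b p)\<^sup>2)" and ?C = "inverse (emeasure ?L ?B)"
  have "?P * emeasure ?L (vnormalize I -` N \<inter> ?B)
      \<le> ?P * emeasure ?L (scale_coords I b -` (vnormalize I -` S \<inter> ?B) \<inter> space ?L)"
    by (intro mult_left_mono emeasure_mono[OF sub] measurable_sets[OF measurable_scale_coords] sets_cone[OF S]) auto
  also have "\<dots> = emeasure ?L (vnormalize I -` S \<inter> ?B)"
    by (rule emeasure_scale_coords[OF I(1) b sets_cone[OF S]])
  finally have "?C * (?P * emeasure ?L (vnormalize I -` N \<inter> ?B)) \<le> ?C * emeasure ?L (vnormalize I -` S \<inter> ?B)"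
    by (rule mult_left_mono) simp
  then have "?P * emeasure (uniform_sphere I) N \<le> emeasure (uniform_sphere I) S"
    by (simp add: emeasure_uniform_sphere[OF S] emeasure_uniform_sphere[OF N] mult_ac)
  then have "(\<Prod>p\<in>I. (b p)\<^sup>2) * measure (uniform_sphere I) N \<le> measure (uniform_sphere I) S"
    by (simp add: emeasure_eq_measure ennreal_mult[symmetric] prod_nonneg)
  moreover have "(\<Prod>p\<in>I. (b p)\<^sup>2) = (\<Prod>p\<in>I. (a p)\<^sup>2) / t ^ card I"
    using t by (simp add: b_def power_divide prod_dividef)
  ultimately show ?thesis
    using t by (simp add: field_simps)
qed

lemma sphere_scale_bound:
  fixes I :: "'i::countable set"
  assumes M: "unitarily_invariant_prob I M" and I: "finite I" "I \<noteq> {}"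
    and N: "N \<in> sets (sphere_algebra I)" "\<And>x. x \<in> N \<Longrightarrow> \<exists>r>0. sphere_cap I x r \<subseteq> N"
    and S: "S \<in> sets (sphere_algebra I)" "\<And>x. x \<in> S \<Longrightarrow> \<exists>r>0. sphere_cap I x r \<subseteq> S"
    and a: "\<And>p. p \<in> I \<Longrightarrow> a p > 0" and t: "t > 0"
    and norm_le: "\<And>\<psi>. \<psi> \<in> N \<Longrightarrow> norm_sq I (scale_coords I a \<psi>) \<le> t"
    and image: "\<And>\<psi>. \<psi> \<in> N \<Longrightarrow> vnormalize I (scale_coords I a \<psi>) \<in> S"
  shows "measure M N * (\<Prod>p\<in>I. (a p)\<^sup>2) \<le> t ^ card I * measure M S"
  using uniform_sphere_scale[OF I N(1) S(1) a t norm_le image]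
    emeasure_sphere_open_unique[OF M unitarily_invariant_uniform_sphere[OF I] I(1) N]
    emeasure_sphere_open_unique[OF M unitarily_invariant_uniform_sphere[OF I] I(1) S]
  by (simp add: measure_def)

subsection \<open>The spectral theorem for Hermitian matrices\<close>

definition cinner :: "complex^'m \<Rightarrow> complex^'m \<Rightarrow> complex" where
  "cinner v w = (\<Sum>i\<in>UNIV. cnj (v $ i) * w $ i)"

lemma cinner_add_left: "cinner (u + v) w = cinner u w + cinner v w"
  and cinner_add_right: "cinner w (u + v) = cinner w u + cinner w v"
  and cinner_diff_right: "cinner w (u - v) = cinner w u - cinner w v"
  and cinner_scale_left: "cinner (c *s u) w = cnj c * cinner u w"
  and cinner_scale_right: "cinner w (c *s u) = c * cinner w u"
  by (simp_all add: cinner_def algebra_simps sum.distrib sum_subtractf sum_distrib_left)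

lemma cnj_cinner [simp]: "cnj (cinner v w) = cinner w v"
  by (simp add: cinner_def mult.commute)

lemma cinner_self: "cinner v v = of_real ((norm v)\<^sup>2)"
  by (simp add: cinner_def norm_vec_def L2_set_def sum_nonneg complex_norm_square mult.commute
      del: of_real_power)

lemma dagger_dagger [simp]: "dagger (dagger A) = A"
  by (simp add: dagger_def vec_eq_iff)

lemma dagger_mult: "dagger (A ** B) = dagger B ** dagger A"
  by (simp add: dagger_def vec_eq_iff matrix_matrix_mult_def mult.commute)

lemma dagger_real_diag [simp]: "dagger (real_diag d) = real_diag d"
  by (simp add: dagger_def vec_eq_iff real_diag_def)

lemma dagger_add: "dagger (A + B) = dagger A + dagger B"
  and dagger_diff: "dagger (A - B) = dagger A - dagger B"
  by (simp_all add: dagger_def vec_eq_iff)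

lemma dagger_mat_1 [simp]: "dagger (mat 1) = mat 1"
  by (simp add: dagger_def vec_eq_iff mat_def)

lemma dagger_diagonalised [simp]: "dagger (U ** real_diag d ** dagger U) = U ** real_diag d ** dagger U"
  by (simp add: dagger_mult matrix_mul_assoc)

lemma cinner_dagger: "cinner v (A *v w) = cinner (dagger A *v v) w"
proof -
  have "cinner v (A *v w) = (\<Sum>i\<in>UNIV. \<Sum>j\<in>UNIV. cnj (v $ i) * (A $ i $ j * w $ j))"
    by (simp add: cinner_def matrix_vector_mult_def sum_distrib_left)
  also have "\<dots> = (\<Sum>j\<in>UNIV. \<Sum>i\<in>UNIV. cnj (v $ i) * (A $ i $ j * w $ j))"
    by (rule sum.swap)
  also have "\<dots> = cinner (dagger A *v v) w"
    by (simp add: cinner_def matrix_vector_mult_def dagger_def sum_distrib_right mult.assoc mult.left_commute)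
  finally show ?thesis .
qed

lemma unitary_matD: "unitary_mat U \<Longrightarrow> dagger U ** U = mat 1" "unitary_mat U \<Longrightarrow> U ** dagger U = mat 1"
  by (simp_all add: unitary_mat_def)

lemma unitary_mat_dagger: "unitary_mat U \<Longrightarrow> unitary_mat (dagger U)"
  by (simp add: unitary_mat_def)

lemma unitary_mat_mult: "unitary_mat U \<Longrightarrow> unitary_mat V \<Longrightarrow> unitary_mat (U ** V)"
  unfolding unitary_mat_def dagger_mult by (metis matrix_mul_assoc matrix_mul_rid)

text \<open>Induction on the index set: the next eigenvector maximises the quadratic form of A on
  the unit sphere of the orthogonal complement \<open>W\<close> of those already found.
  \<open>W\<close> is invariant because A is Hermitian.\<close>

lemma hermitian_eigenvectors:
  fixes A :: "complex^'m^'m" and S :: "'m set"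
  assumes A: "dagger A = A" and "finite S"
  shows "\<exists>u d. (\<forall>i\<in>S. \<forall>j\<in>S. cinner (u i) (u j) = (if i = j then 1 else 0)) \<and>
    (\<forall>i\<in>S. A *v u i = complex_of_real (d i) *s u i)"
  using assms(2)
proof (induction S)
  case (insert k S)
  then obtain u :: "'m \<Rightarrow> complex^'m" and d where
    u: "\<And>i j. i \<in> S \<Longrightarrow> j \<in> S \<Longrightarrow> cinner (u i) (u j) = (if i = j then 1 else 0)"
    and d: "\<And>i. i \<in> S \<Longrightarrow> A *v u i = complex_of_real (d i) *s u i"
    by blast
  define W where "W = {v. \<forall>i\<in>S. cinner (u i) v = 0}"
  have W_add: "v + w \<in> W" if "v \<in> W" "w \<in> W" for v w using that by (simp add: W_def cinner_add_right)
  have W_scale: "c *s v \<in> W" if "v \<in> W" for c v using that by (simp add: W_def cinner_scale_right)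
  have W_A: "A *v v \<in> W" if "v \<in> W" for v
    using that by (simp add: W_def cinner_dagger A d cinner_scale_left)
  define f where "f v = Re (cinner v (A *v v))" for v
  have f_scale: "f (complex_of_real c *s v) = c\<^sup>2 * f v" for c v
    by (simp add: f_def matrix_vector_mult_scaleR[symmetric] vec.scale cinner_scale_left cinner_scale_right power2_eq_square)
  have norm_scale: "norm (complex_of_real c *s v) = \<bar>c\<bar> * norm v" for c and v :: "complex^'m"
    by (simp add: norm_vec_def norm_mult L2_set_right_distrib)
  \<comment> \<open>The kernel of \<open>C\<close> is \<open>W\<close>, and row k of
    \<open>C\<close> is zero because k is not in S. Hence \<open>C\<close> is singular and
    \<open>W\<close> contains a nonzero vector.\<close>
  define C :: "complex^'m^'m" where "C = (\<chi> i j. if i \<in> S then cnj (u i $ j) else 0)"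
  have "\<not> invertible C"
  proof
    assume "invertible C"
    then obtain C' where "C ** C' = mat 1" by (auto simp: invertible_def)
    then have "(C ** C') $ k $ k = 1" by (simp add: mat_def)
    then show False using insert.hyps by (simp add: matrix_matrix_mult_def C_def)
  qed
  then obtain x where x: "C *v x = 0" "x \<noteq> 0"
    by (metis invertible_left_inverse matrix_left_invertible_ker)
  have "x \<in> W"
    unfolding W_def
  proof (intro CollectI ballI)
    fix i assume "i \<in> S"
    then have "(C *v x) $ i = cinner (u i) x" by (simp add: C_def matrix_vector_mult_def cinner_def)
    then show "cinner (u i) x = 0" using x by simp
  qed
  define K where "K = W \<inter> sphere 0 1"
  have "complex_of_real (1 / norm x) *s x \<in> K"
    using W_scale[OF \<open>x \<in> W\<close>] x(2) by (simp add: K_def norm_scale del: of_real_divide)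
  then have "K \<noteq> {}" by blast
  have "closed {v. cinner (u i) v = 0}" for i
    unfolding cinner_def by (intro closed_Collect_eq continuous_intros)
  moreover have "W = (\<Inter>i\<in>S. {v. cinner (u i) v = 0})" by (auto simp: W_def)
  ultimately have "closed W" by auto
  then have "compact K"
    unfolding K_def by (intro closed_Int_compact) auto
  have "continuous_on K f"
    unfolding f_def cinner_def matrix_vector_mult_def by (auto intro!: continuous_intros)
  then obtain v where v: "v \<in> K" "\<And>w. w \<in> K \<Longrightarrow> f w \<le> f v"
    using continuous_attains_sup[OF \<open>compact K\<close> \<open>K \<noteq> {}\<close>] by blast
  then have vW: "v \<in> W" and v1: "norm v = 1" by (auto simp: K_def)
  define L where "L = f v"
  have fL: "f w \<le> L * (norm w)\<^sup>2" if "w \<in> W" for w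
  proof (cases "w = 0")
    case False
    then have "complex_of_real (1 / norm w) *s w \<in> K"
      using W_scale[OF that] by (simp add: K_def norm_scale del: of_real_divide)
    then have "(1 / norm w)\<^sup>2 * f w \<le> L" using v(2) f_scale L_def by metis
    then show ?thesis using False by (simp add: field_simps)
  qed (simp add: f_def cinner_def)
  define r where "r = A *v v - complex_of_real L *s v"
  have rW: "r \<in> W"
    using W_add[OF W_A[OF vW] W_scale[OF vW, of "- complex_of_real L"]] by (simp add: r_def)
  define R where "R = (norm r)\<^sup>2"
  define c where "c = f r - L * R"
  \<comment> \<open>Compare \<open>f\<close> with \<open>L\<close> times the squared norm at the
    perturbed point v + t r. The constant terms and the inner products of v with r cancel, leaving
    the residual's squared norm \<open>R\<close> as the linear coefficient.\<close>
  have quad: "2 * t * R + t\<^sup>2 * c \<le> 0" for t :: real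
  proof -
    let ?w = "v + complex_of_real t *s r"
    have 1: "cinner r (A *v v) = of_real R + of_real L * cinner r v"
    proof -
      have "A *v v = r + complex_of_real L *s v" by (simp add: r_def)
      then show ?thesis by (simp only: cinner_add_right cinner_scale_right cinner_self R_def)
    qed
    have 2: "cinner v (A *v r) = of_real R + of_real L * cinner v r"
      using arg_cong[OF 1, of cnj] by (simp add: cinner_dagger[of v] A)
    have "cinner ?w (A *v ?w) = cinner v (A *v v) + of_real t * cinner v (A *v r)
        + of_real t * cinner r (A *v v) + of_real (t\<^sup>2) * cinner r (A *v r)"
      by (simp add: matrix_vector_right_distrib vec.scale cinner_add_left cinner_add_right cinner_scale_left
          cinner_scale_right algebra_simps power2_eq_square)
    then have "f ?w = L + t * (R + L * Re (cinner v r)) + t * (R + L * Re (cinner r v)) + t\<^sup>2 * f r"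
      by (simp add: f_def L_def 1 2)
    moreover have "of_real ((norm ?w)\<^sup>2) = cinner v v + of_real t * cinner v r + of_real t * cinner r v + of_real (t\<^sup>2) * cinner r r"
      unfolding cinner_self[of ?w, symmetric]
      by (simp add: cinner_add_left cinner_add_right cinner_scale_left cinner_scale_right algebra_simps power2_eq_square)
    then have "Re (of_real ((norm ?w)\<^sup>2)) = Re (cinner v v + of_real t * cinner v r + of_real t * cinner r v + of_real (t\<^sup>2) * cinner r r)"
      by (rule arg_cong)
    then have "(norm ?w)\<^sup>2 = 1 + t * Re (cinner v r) + t * Re (cinner r v) + t\<^sup>2 * R"
      by (simp add: cinner_self v1 R_def del: of_real_power)
    moreover have "f ?w \<le> L * (norm ?w)\<^sup>2"
      by (rule fL[OF W_add[OF vW W_scale[OF rW]]])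
    ultimately show ?thesis by (simp add: c_def algebra_simps)
  qed
  have "R = 0"
  proof (rule ccontr)
    assume "R \<noteq> 0"
    then have R: "R > 0" by (simp add: R_def)
    \<comment> \<open>This t is small enough that the quadratic term cannot compensate the linear
      term, so a nonzero residual contradicts maximality.\<close>
    define t where "t = R / (\<bar>c\<bar> + 1)"
    have t: "t > 0" "t * \<bar>c\<bar> \<le> R" using R by (simp_all add: t_def field_simps)
    have "t * (2 * R + t * c) \<le> 0" using quad[of t] by (simp add: power2_eq_square algebra_simps)
    then have "2 * R + t * c \<le> 0" using t(1) by (simp add: mult_le_0_iff)
    moreover have "t * c \<ge> - (t * \<bar>c\<bar>)" using t(1) by (simp add: abs_if)
    ultimately show False using t(2) R by linarith
  qed
  then have eig: "A *v v = complex_of_real L *s v" by (simp add: R_def r_def)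
  have orth: "cinner (u i) v = 0" "cinner v (u i) = 0" if "i \<in> S" for i
    using vW that cnj_cinner[of "u i" v] by (auto simp: W_def simp del: cnj_cinner)
  have vv: "cinner v v = 1" by (simp add: cinner_self v1)
  show ?case
    using insert.hyps u d eig orth
    by (intro exI[of _ "u(k := v)"] exI[of _ "d(k := L)"]) (auto simp: vv)
qed simp

theorem hermitian_diagonalisable:
  fixes A :: "complex^'m^'m"
  assumes A: "dagger A = A"
  obtains U d where "unitary_mat U" "A = U ** real_diag d ** dagger U"
proof -
  obtain u :: "'m \<Rightarrow> complex^'m" and d where
    u: "\<And>i j. cinner (u i) (u j) = (if i = j then 1 else 0)" and d: "\<And>i. A *v u i = complex_of_real (d i) *s u i"
    using hermitian_eigenvectors[OF A, of UNIV] by auto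
  define U :: "complex^'m^'m" where "U = (\<chi> i j. u j $ i)"
  have "dagger U ** U = mat 1"
    using u by (simp add: vec_eq_iff matrix_matrix_mult_def dagger_def U_def mat_def cinner_def)
  moreover from this have "U ** dagger U = mat 1"
    by (simp add: matrix_left_right_inverse)
  ultimately have U: "unitary_mat U" by (simp add: unitary_mat_def)
  have "A ** U = U ** real_diag d"
  proof -
    have "(A ** U) $ i $ j = (A *v u j) $ i" for i j
      by (simp add: matrix_matrix_mult_def matrix_vector_mult_def U_def)
    then show ?thesis
      by (simp add: vec_eq_iff d) (simp add: matrix_matrix_mult_def real_diag_def U_def if_distrib if_distribR mult.commute cong: if_cong)
  qed
  then have "A = U ** real_diag d ** dagger U"
    using unitary_matD(2)[OF U] by (metis matrix_mul_assoc matrix_mul_rid)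
  then show ?thesis using that U by blast
qed

subsection \<open>Trace norm and the topology of the state space\<close>

lemma trace_conj:
  fixes U V :: "complex^'m^'m"
  assumes "V ** U = mat 1" shows "trace (U ** B ** V) = trace B"
  using assms by (subst trace_mul_sym) (simp add: matrix_mul_assoc)

lemma trace_unitary_conj [simp]: "unitary_mat U \<Longrightarrow> trace (U ** B ** dagger U) = trace B"
  by (simp add: trace_conj unitary_matD)

lemma trace_real_diag [simp]: "trace (real_diag d) = of_real (\<Sum>i\<in>UNIV. d i)"
  by (simp add: trace_def real_diag_def)

lemma real_diag_mult_nth: "(real_diag d ** A) $ i $ j = of_real (d i) * A $ i $ j"
  by (simp add: matrix_matrix_mult_def real_diag_def if_distrib if_distribR cong: if_cong)

lemma real_diag_mult: "real_diag d ** real_diag e = real_diag (\<lambda>i. d i * e i)"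
  unfolding vec_eq_iff real_diag_mult_nth by (simp add: real_diag_def)

lemma conj_mult:
  assumes "unitary_mat U"
  shows "(U ** A ** dagger U) ** (U ** B ** dagger U) = U ** (A ** B) ** dagger U"
proof -
  have "(U ** A ** dagger U) ** (U ** B ** dagger U) = U ** A ** (dagger U ** U) ** B ** dagger U"
    by (simp add: matrix_mul_assoc)
  then show ?thesis by (simp add: unitary_matD(1)[OF assms] matrix_mul_assoc)
qed

lemma conj_cancel:
  assumes "unitary_mat U"
  shows "dagger U ** (U ** A ** dagger U) ** U = A"
proof -
  have "dagger U ** (U ** A ** dagger U) ** U = (dagger U ** U) ** A ** (dagger U ** U)"
    by (simp add: matrix_mul_assoc)
  then show ?thesis by (simp add: unitary_matD(1)[OF assms])
qed

lemma trace_norm_eq: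
  assumes U: "unitary_mat U"
  shows "trace_norm (U ** real_diag d ** dagger U) = (\<Sum>i\<in>UNIV. \<bar>d i\<bar>)"
  by (simp add: trace_norm_def conj_mult U real_diag_mult matrix_fun_eq o_def)

lemma norm_sq_trace:
  fixes A :: "complex^'m^'m"
  shows "complex_of_real ((norm A)\<^sup>2) = trace (dagger A ** A)"
proof -
  have "(norm A)\<^sup>2 = (\<Sum>i\<in>UNIV. \<Sum>j\<in>UNIV. (cmod (A $ i $ j))\<^sup>2)"
    by (simp add: norm_vec_def L2_set_def sum_nonneg)
  also have "complex_of_real \<dots> = (\<Sum>i\<in>UNIV. \<Sum>j\<in>UNIV. cnj (A $ i $ j) * A $ i $ j)"
    by (simp add: complex_norm_square mult.commute del: of_real_power)
  also have "\<dots> = trace (dagger A ** A)"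
    by (subst sum.swap) (simp add: trace_def matrix_matrix_mult_def dagger_def)
  finally show ?thesis .
qed

lemma norm_diagonalised:
  assumes U: "unitary_mat U"
  shows "(norm (U ** real_diag d ** dagger U))\<^sup>2 = (\<Sum>i\<in>UNIV. (d i)\<^sup>2)"
proof -
  have "complex_of_real ((norm (U ** real_diag d ** dagger U))\<^sup>2) = of_real (\<Sum>i\<in>UNIV. (d i)\<^sup>2)"
    unfolding norm_sq_trace
    by (simp add: conj_mult U real_diag_mult power2_eq_square)
  then show ?thesis using of_real_eq_iff by blast
qed

text \<open>On eigenvalues this is the comparison of the Euclidean norm with the sum of absolute
  values. Together with \<open>trace_norm_le_norm\<close> it makes the trace distance equivalent to
  the Euclidean distance of matrices.\<close>

lemma norm_le_trace_norm:
  assumes "dagger A = A" shows "norm A \<le> trace_norm A"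
proof -
  obtain U d where U: "unitary_mat U" "A = U ** real_diag d ** dagger U"
    using hermitian_diagonalisable[OF assms] .
  have "(norm A)\<^sup>2 = (\<Sum>i\<in>UNIV. \<bar>d i\<bar>\<^sup>2)" by (simp add: U(2) norm_diagonalised[OF U(1)])
  then have "norm A = L2_set (\<lambda>i. \<bar>d i\<bar>) UNIV" by (simp add: L2_set_def real_sqrt_unique)
  also have "\<dots> \<le> (\<Sum>i\<in>UNIV. \<bar>d i\<bar>)" by (rule L2_set_le_sum) simp
  finally show ?thesis by (simp add: U(2) trace_norm_eq[OF U(1)])
qed

lemma trace_norm_le_norm:
  fixes A :: "complex^'m^'m"
  assumes "dagger A = A" shows "trace_norm A \<le> real CARD('m) * norm A"
proof -
  obtain U d where U: "unitary_mat U" "A = U ** real_diag d ** dagger U"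
    using hermitian_diagonalisable[OF assms] .
  have "\<bar>d i\<bar> \<le> norm A" for i
  proof -
    have "(d i)\<^sup>2 \<le> (norm A)\<^sup>2"
      unfolding U(2) norm_diagonalised[OF U(1)] by (intro member_le_sum) auto
    then show ?thesis by (simp add: abs_le_square_iff[symmetric])
  qed
  then have "(\<Sum>i\<in>UNIV. \<bar>d i\<bar>) \<le> of_nat CARD('m) * norm A" by (intro sum_bounded_above)
  then show ?thesis by (simp add: U(2) trace_norm_eq[OF U(1)])
qed

text \<open>Half of the duality between trace norm and operator norm. In the two eigenbases the
  trace becomes a sum of d i * s j weighted by the squared moduli of a unitary matrix, and each row
  of these weights sums to 1.\<close>

lemma trace_mult_le_trace_norm:
  fixes A :: "complex^'m^'m"
  assumes A: "dagger A = A" and V: "unitary_mat V" and s: "\<And>i. \<bar>s i\<bar> \<le> 1"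
  shows "Re (trace (A ** (V ** real_diag s ** dagger V))) \<le> trace_norm A"
proof -
  obtain U d where U: "unitary_mat U" "A = U ** real_diag d ** dagger U"
    using hermitian_diagonalisable[OF A] .
  define Z where "Z = dagger U ** V"
  have Z: "Z ** dagger Z = mat 1"
    using unitary_mat_mult[OF unitary_mat_dagger[OF U(1)] V] by (simp add: Z_def unitary_mat_def)
  have row: "(\<Sum>j\<in>UNIV. (cmod (Z $ i $ j))\<^sup>2) = 1" for i
  proof -
    have "complex_of_real (\<Sum>j\<in>UNIV. (cmod (Z $ i $ j))\<^sup>2) = (Z ** dagger Z) $ i $ i"
      by (simp add: matrix_matrix_mult_def dagger_def complex_norm_square del: of_real_power)
    also have "\<dots> = 1" by (simp add: Z mat_def)
    finally show ?thesis by (metis of_real_eq_1_iff)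
  qed
  have "trace (A ** (V ** real_diag s ** dagger V)) = trace (U ** (real_diag d ** (Z ** real_diag s ** dagger Z)) ** dagger U)"
  proof -
    have "U ** (real_diag d ** (Z ** real_diag s ** dagger Z)) ** dagger U
        = A ** (V ** real_diag s ** dagger V) ** (U ** dagger U)"
      by (simp add: Z_def U(2) dagger_mult matrix_mul_assoc)
    then show ?thesis by (simp add: unitary_matD U(1))
  qed
  also have "\<dots> = trace (real_diag d ** (Z ** real_diag s ** dagger Z))"
    by (simp add: U(1))
  also have "\<dots> = (\<Sum>i\<in>UNIV. \<Sum>j\<in>UNIV. of_real (d i * s j * (cmod (Z $ i $ j))\<^sup>2))"
  proof -
    have "(Z ** real_diag s) $ i $ j = Z $ i $ j * of_real (s j)" for i j
      by (simp add: matrix_matrix_mult_def real_diag_def if_distrib if_distribR cong: if_cong)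
    then have "(Z ** real_diag s ** dagger Z) $ i $ i = (\<Sum>j\<in>UNIV. of_real (s j * (cmod (Z $ i $ j))\<^sup>2))" for i
      unfolding matrix_matrix_mult_def[of "Z ** real_diag s"]
      by (simp add: dagger_def complex_norm_square mult_ac del: of_real_power)
    then show ?thesis
      by (simp add: trace_def real_diag_mult_nth sum_distrib_left mult.assoc)
  qed
  finally have "Re (trace (A ** (V ** real_diag s ** dagger V))) = (\<Sum>i\<in>UNIV. \<Sum>j\<in>UNIV. d i * s j * (cmod (Z $ i $ j))\<^sup>2)"
    by (simp flip: of_real_sum)
  also have "\<dots> \<le> (\<Sum>i\<in>UNIV. \<Sum>j\<in>UNIV. \<bar>d i\<bar> * (cmod (Z $ i $ j))\<^sup>2)"
  proof (intro sum_mono mult_right_mono)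
    fix i j
    have "d i * s j \<le> \<bar>d i\<bar> * \<bar>s j\<bar>" by (metis abs_ge_self abs_mult)
    also have "\<dots> \<le> \<bar>d i\<bar> * 1" by (intro mult_left_mono s) simp
    finally show "d i * s j \<le> \<bar>d i\<bar>" by simp
  qed simp
  also have "\<dots> = (\<Sum>i\<in>UNIV. \<bar>d i\<bar>)"
    by (simp add: sum_distrib_left[symmetric] row)
  finally show ?thesis by (simp add: U(2) trace_norm_eq[OF U(1)])
qed

text \<open>The sign matrix \<open>?S\<close> of A + B attains the trace norm of A + B and is an
  admissible test matrix for A and B separately.\<close>

lemma trace_norm_triangle:
  assumes A: "dagger A = A" and B: "dagger B = B"
  shows "trace_norm (A + B) \<le> trace_norm A + trace_norm B"
proof -
  have "dagger (A + B) = A + B" by (simp add: dagger_add A B)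
  then obtain U d where U: "unitary_mat U" "A + B = U ** real_diag d ** dagger U"
    using hermitian_diagonalisable by blast
  let ?S = "U ** real_diag (\<lambda>i. sgn (d i)) ** dagger U"
  have "trace_norm (A + B) = (\<Sum>i\<in>UNIV. d i * sgn (d i))"
    by (simp add: U(2) trace_norm_eq[OF U(1)] abs_sgn)
  also have "\<dots> = Re (trace ((A + B) ** ?S))"
    by (simp add: U conj_mult real_diag_mult)
  also have "\<dots> = Re (trace (A ** ?S)) + Re (trace (B ** ?S))"
    by (simp add: trace_def matrix_matrix_mult_def distrib_right sum.distrib)
  also have "\<dots> \<le> trace_norm A + trace_norm B"
    by (intro add_mono trace_mult_le_trace_norm A B U(1)) (simp_all add: abs_sgn_eq)
  finally show ?thesis .
qed

text \<open>\<open>psd\<close> only constrains the quadratic form. Since the form is real, it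
  vanishes for A - dagger A, and polarisation with v + w and v + \<i> w shows that this matrix is
  zero.\<close>

lemma psd_hermitian:
  assumes "psd A" shows "dagger A = A"
proof -
  have "cinner v (A *v v) \<in> \<real>\<^sub>\<ge>\<^sub>0" for v
    using assms by (simp add: psd_def cinner_def)
  then have "cinner v (A *v v) \<in> \<real>" for v
    using nonneg_Reals_subset_Reals by blast
  then have cnj: "cinner v (A *v v) = cinner v (dagger A *v v)" for v
    by (metis Reals_cnj_iff cinner_dagger cnj_cinner dagger_dagger)
  define B where "B = A - dagger A"
  have B: "cinner v (B *v v) = 0" for v
    using cnj[of v] by (simp add: B_def matrix_vector_mult_diff_rdistrib cinner_diff_right)
  have pol: "cinner v (B *v w) = 0" for v w
  proof -
    have "cinner v (B *v w) + cinner w (B *v v) = 0"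
      using B[of "v + w"] by (simp add: matrix_vector_right_distrib cinner_add_left cinner_add_right B add.commute)
    moreover have "\<i> * cinner v (B *v w) - \<i> * cinner w (B *v v) = 0"
      using B[of "v + \<i> *s w"]
      by (simp add: matrix_vector_right_distrib vec.scale cinner_add_left cinner_add_right cinner_scale_left cinner_scale_right B)
    ultimately show ?thesis by (simp add: algebra_simps)
  qed
  have "B *v w = 0" for w
    using pol[of "B *v w" w] by (simp add: cinner_self)
  then have "B = 0" by (simp add: matrix_eq)
  then show ?thesis by (simp add: B_def)
qed

lemma density_hermitian: "\<rho> \<in> density_ops \<Longrightarrow> dagger \<rho> = \<rho>"
  by (simp add: density_ops_def psd_hermitian)

lemma dagger_uminus: "dagger (- A) = - dagger A"
  by (simp add: dagger_def vec_eq_iff)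

lemma matrix_mult_uminus: "(- A) ** (- B) = A ** (B :: complex^'m^'m)"
  by (simp add: matrix_matrix_mult_def)

section \<open>The trace distance as a metric on density operators\<close>

interpretation state_metric: Metric_space density_ops "trace_dist :: complex^'m^'m \<Rightarrow> _"
proof
  fix x y z :: "complex^'m^'m"
  \<comment> \<open>\<open>Metric_space\<close> asks for this outside the carrier too, where x - y
    need not be Hermitian. So the positive matrix dagger (x - y) ** (x - y) is diagonalised instead;
    its eigenvalues are squared column norms of \<open>Z\<close>.\<close>
  show "0 \<le> trace_dist x y"
  proof -
    obtain U d where U: "unitary_mat U" "dagger (x - y) ** (x - y) = U ** real_diag d ** dagger U"
      using hermitian_diagonalisable[of "dagger (x - y) ** (x - y)"] by (auto simp: dagger_mult)
    define Z where "Z = (x - y) ** U"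
    have "dagger Z ** Z = real_diag d"
      using conj_cancel[OF U(1), of "real_diag d"] unfolding U(2)[symmetric]
      by (simp add: Z_def dagger_mult matrix_mul_assoc)
    then have "complex_of_real (d i) = (dagger Z ** Z) $ i $ i" for i
      by (simp add: real_diag_def)
    also have "(dagger Z ** Z) $ i $ i = of_real (\<Sum>j\<in>UNIV. (cmod (Z $ j $ i))\<^sup>2)" for i
      by (simp add: matrix_matrix_mult_def dagger_def complex_norm_square mult.commute del: of_real_power)
    finally have "d i = (\<Sum>j\<in>UNIV. (cmod (Z $ j $ i))\<^sup>2)" for i
      using of_real_eq_iff by blast
    then have "d i \<ge> 0" for i by (simp add: sum_nonneg)
    then show ?thesis
      by (simp add: trace_dist_def trace_norm_def U matrix_fun_eq sum_nonneg)
  qed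
  show "trace_dist x y = trace_dist y x"
  proof -
    have "dagger (x - y) ** (x - y) = dagger (y - x) ** (y - x)"
      using minus_diff_eq[of x y] by (metis dagger_uminus matrix_mult_uminus)
    then show ?thesis by (simp add: trace_dist_def trace_norm_def)
  qed
  assume x: "x \<in> density_ops" and y: "y \<in> density_ops"
  have xy: "dagger (x - y) = x - y" by (simp add: dagger_diff density_hermitian x y)
  show "trace_dist x y = 0 \<longleftrightarrow> x = y"
    using norm_le_trace_norm[OF xy] trace_norm_le_norm[OF xy] by (auto simp: trace_dist_def)
  assume z: "z \<in> density_ops"
  have yz: "dagger (y - z) = y - z" by (simp add: dagger_diff density_hermitian y z)
  show "trace_dist x z \<le> trace_dist x y + trace_dist y z"
    using trace_norm_triangle[OF xy yz] by (simp add: trace_dist_def)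
qed

text \<open>For states, the Euclidean distance is at most twice the trace distance, which in turn is
  at most m times the Euclidean one. Closure and interior can thus be handled in the subspace
  topology.\<close>

lemma state_topology_eq: "(state_topology :: (complex^'m^'m) topology) = top_of_set density_ops"
proof (rule topology_eq[THEN iffD2], rule allI)
  fix S :: "(complex^'m^'m) set"
  have le: "dist x y \<le> 2 * trace_dist x y" "2 * trace_dist x y \<le> real CARD('m) * dist x y"
    if "x \<in> density_ops" "y \<in> density_ops" for x y :: "complex^'m^'m"
  proof -
    have "dagger (x - y) = x - y" by (simp add: dagger_diff density_hermitian that)
    from norm_le_trace_norm[OF this] trace_norm_le_norm[OF this]
    show "dist x y \<le> 2 * trace_dist x y" "2 * trace_dist x y \<le> real CARD('m) * dist x y"
      by (simp_all add: trace_dist_def dist_norm)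
  qed
  have m: "real CARD('m) > 0" by simp
  show "openin state_topology S \<longleftrightarrow> openin (top_of_set density_ops) S"
    unfolding state_topology_def state_metric.openin_mtopology openin_euclidean_subtopology_iff
  proof (intro conj_cong refl iffI ballI allI impI)
    assume S: "S \<subseteq> density_ops"
    {
      fix x assume *: "\<forall>x. x \<in> S \<longrightarrow> (\<exists>r>0. state_metric.mball x r \<subseteq> S)" and x: "x \<in> S"
      then obtain r where r: "r > 0" "state_metric.mball x r \<subseteq> S" by blast
      have "y \<in> S" if "y \<in> density_ops" "dist y x < 2 * r / real CARD('m)" for y
      proof -
        have "real CARD('m) * dist x y < 2 * r" using that(2) m by (simp add: field_simps dist_commute)
        then have "trace_dist x y < r" using le(2)[of x y] x S that by fastforce
        then have "y \<in> state_metric.mball x r" using x S that by (auto simp: state_metric.in_mball)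
        then show ?thesis using r(2) by blast
      qed
      then show "\<exists>e>0. \<forall>x'\<in>density_ops. dist x' x < e \<longrightarrow> x' \<in> S"
        using r(1) m by (intro exI[of _ "2 * r / real CARD('m)"]) auto
    next
      fix x assume *: "\<forall>x\<in>S. \<exists>e>0. \<forall>x'\<in>density_ops. dist x' x < e \<longrightarrow> x' \<in> S" and x: "x \<in> S"
      then obtain e where e: "e > 0" "\<And>y. y \<in> density_ops \<Longrightarrow> dist y x < e \<Longrightarrow> y \<in> S" by blast
      have "state_metric.mball x (e / 2) \<subseteq> S"
      proof
        fix y assume "y \<in> state_metric.mball x (e / 2)"
        then have y: "y \<in> density_ops" "trace_dist x y < e / 2" "x \<in> density_ops" by (auto simp: state_metric.in_mball)
        then have "dist y x < e" using le(1)[of x y] by (simp add: dist_commute)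
        then show "y \<in> S" using e y by blast
      qed
      then show "\<exists>r>0. state_metric.mball x r \<subseteq> S" using e(1) by (intro exI[of _ "e / 2"]) auto
    }
  qed
qed

section \<open>Spectra of density operators and compactness of the state space\<close>

lemma density_diagonalised:
  fixes \<rho> :: "complex^'m^'m"
  assumes "\<rho> \<in> density_ops"
  obtains U d where "unitary_mat U" "\<rho> = U ** real_diag d ** dagger U" "\<And>i. d i \<ge> 0" "(\<Sum>i\<in>UNIV. d i) = 1"
proof -
  obtain U d where U: "unitary_mat U" "\<rho> = U ** real_diag d ** dagger U"
    using hermitian_diagonalisable[OF density_hermitian[OF assms]] .
  have "complex_of_real (\<Sum>i\<in>UNIV. d i) = trace \<rho>" by (simp add: U)
  also have "\<dots> = 1" using assms by (simp add: density_ops_def)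
  finally have sum: "(\<Sum>i\<in>UNIV. d i) = 1" by (metis of_real_eq_1_iff)
  have "d k \<ge> 0" for k
  proof -
    \<comment> \<open>An eigenvector for the eigenvalue \<open>d k\<close>, where positivity of the
      quadratic form says that \<open>d k\<close> is nonnegative.\<close>
    define v where "v = U *v axis k 1"
    have "dagger U *v v = axis k 1"
      by (simp add: v_def matrix_vector_mul_assoc unitary_matD(1)[OF U(1)])
    then have "cinner v (\<rho> *v v) = cinner (axis k 1) (real_diag d *v axis k 1)"
      by (simp add: U(2) matrix_vector_mul_assoc[symmetric] cinner_dagger[of v U])
    also have "\<dots> = complex_of_real (d k)"
    proof -
      have "(real_diag d *v axis k 1) $ i = (if i = k then complex_of_real (d k) else 0)" for i
        using sum.remove[of UNIV k "\<lambda>j. real_diag d $ i $ j * axis k 1 $ j"]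
        by (auto simp: matrix_vector_mult_def real_diag_def axis_def)
      then have "cinner (axis k 1) (real_diag d *v axis k 1) = (\<Sum>i\<in>UNIV. if i = k then complex_of_real (d k) else 0)"
        unfolding cinner_def by (intro sum.cong) (auto simp: axis_def)
      then show ?thesis by simp
    qed
    finally have "cinner v (\<rho> *v v) = complex_of_real (d k)" .
    moreover have "cinner v (\<rho> *v v) \<in> \<real>\<^sub>\<ge>\<^sub>0"
      using assms by (simp add: density_ops_def psd_def cinner_def)
    ultimately show ?thesis by simp
  qed
  then show ?thesis using that U sum by blast
qed

lemma compact_density_ops: "compact (density_ops :: (complex^'m^'m) set)"
proof -
  have "closed {A :: complex^'m^'m. cinner v (A *v v) \<in> \<real>\<^sub>\<ge>\<^sub>0}" for v
    unfolding cinner_def matrix_vector_mult_def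
    by (intro closed_vimage[of "\<real>\<^sub>\<ge>\<^sub>0", unfolded vimage_def] closed_nonneg_Reals_complex) (auto intro!: continuous_intros)
  moreover have "closed {A :: complex^'m^'m. trace A = 1}"
    unfolding trace_def by (intro closed_Collect_eq continuous_intros)
  moreover have "density_ops = (\<Inter>v. {A :: complex^'m^'m. cinner v (A *v v) \<in> \<real>\<^sub>\<ge>\<^sub>0}) \<inter> {A. trace A = 1}"
    by (auto simp: density_ops_def psd_def cinner_def)
  ultimately have "closed (density_ops :: (complex^'m^'m) set)"
    by (metis (no_types, lifting) closed_INT closed_Int)
  moreover have "norm \<rho> \<le> 1" if \<rho>: "\<rho> \<in> density_ops" for \<rho> :: "complex^'m^'m"
  proof -
    obtain U d where "unitary_mat U" "\<rho> = U ** real_diag d ** dagger U" "\<And>i. d i \<ge> 0" "(\<Sum>i\<in>UNIV. d i) = 1"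
      using density_diagonalised[OF \<rho>] by blast
    then show ?thesis using norm_le_trace_norm[OF density_hermitian[OF \<rho>]] by (simp add: trace_norm_eq)
  qed
  ultimately show ?thesis by (auto simp: compact_eq_bounded_closed bounded_iff)
qed

subsection \<open>Relative entropy of the maximally mixed state\<close>

lemma det_diagonalised:
  fixes U :: "complex^'m^'m"
  assumes U: "unitary_mat U"
  shows "det (U ** real_diag d ** dagger U) = of_real (\<Prod>i\<in>UNIV. d i)"
proof -
  have "det U * det (dagger U) = 1"
    by (metis det_I det_mul unitary_matD(2)[OF U])
  moreover have "det (real_diag d :: complex^'m^'m) = of_real (\<Prod>i\<in>UNIV. d i)"
    by (subst det_diagonal) (simp_all add: real_diag_def)
  ultimately show ?thesis by (simp add: det_mul mult.commute mult.left_commute)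
qed

lemma max_mixed_eq: "(max_mixed :: complex^'m^'m) = real_diag (\<lambda>_. 1 / real CARD('m))"
  by (simp add: max_mixed_def real_diag_def mat_def vec_eq_iff of_real_def inverse_eq_divide)

text \<open>The maximally mixed state is a multiple of the identity, so the entropy involves \<rho>
  only through the trace of its logarithm, which is the logarithm of its determinant. All later
  estimates are therefore about determinants.\<close>

lemma rel_entropy_max_mixed:
  fixes \<rho> :: "complex^'m^'m"
  assumes \<rho>: "\<rho> \<in> density_ops"
  shows "rel_entropy max_mixed \<rho> =
    (if Re (det \<rho>) > 0 then ereal (- ln (real CARD('m)) - ln (Re (det \<rho>)) / real CARD('m)) else \<infinity>)"
proof (cases "Re (det \<rho>) > 0")
  case False
  obtain U d where U: "unitary_mat U" "\<rho> = U ** real_diag d ** dagger U" "\<And>i. d i \<ge> 0"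
    using density_diagonalised[OF \<rho>] by blast
  have det: "det \<rho> = of_real (\<Prod>i\<in>UNIV. d i)" unfolding U(2) by (rule det_diagonalised[OF U(1)])
  then have "Re (det \<rho>) = (\<Prod>i\<in>UNIV. d i)" by (metis Re_complex_of_real)
  then have "(\<Prod>i\<in>UNIV. d i) \<le> 0" using False by simp
  then have "(\<Prod>i\<in>UNIV. d i) = 0" using U(3) by (intro order_antisym prod_nonneg) auto
  then have "det \<rho> = 0" by (simp only: det of_real_0)
  then have "\<not> invertible \<rho>" by (simp add: invertible_det_nz)
  then show ?thesis using False rel_entropy_max_mixed_singular by simp
next
  case True
  let ?m = "real CARD('m)"
  have m: "?m > 0" by simp
  obtain U d where U: "unitary_mat U" "\<rho> = U ** real_diag d ** dagger U" "\<And>i. d i \<ge> 0"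
    using density_diagonalised[OF \<rho>] by blast
  have det: "det \<rho> = of_real (\<Prod>i\<in>UNIV. d i)" unfolding U(2) by (rule det_diagonalised[OF U(1)])
  then have Re_det: "Re (det \<rho>) = (\<Prod>i\<in>UNIV. d i)" by (metis Re_complex_of_real)
  then have "(\<Prod>i\<in>UNIV. d i) \<noteq> 0" using True by linarith
  then have "d i \<noteq> 0" for i by (auto simp: prod_zero_iff)
  then have d: "d i > 0" for i using U(3)[of i] by (simp add: order_less_le)
  have lndet: "ln (Re (det \<rho>)) = (\<Sum>i\<in>UNIV. ln (d i))"
    unfolding Re_det using \<open>\<And>i. d i \<noteq> 0\<close> by (intro ln_prod) auto
  have "invertible \<rho>" using True by (auto simp: invertible_det_nz)
  then have ker: "\<forall>v. \<rho> *v v = 0 \<longrightarrow> max_mixed *v v = 0"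
    by (metis invertible_left_inverse matrix_left_invertible_ker matrix_vector_mult_0_right)
  have mm: "(max_mixed :: complex^'m^'m) = mat 1 ** real_diag (\<lambda>_. 1 / ?m) ** dagger (mat 1)"
    by (simp add: max_mixed_eq)
  have U1: "unitary_mat (mat 1 :: complex^'m^'m)" by (simp add: unitary_mat_def)
  have lnm: "matrix_fun ln (max_mixed :: complex^'m^'m) = real_diag (\<lambda>_. ln (1 / ?m))"
    unfolding mm matrix_fun_eq[OF U1] by (simp add: o_def)
  have ln\<rho>: "matrix_fun ln \<rho> = U ** real_diag (ln \<circ> d) ** dagger U"
    unfolding U(2) by (rule matrix_fun_eq[OF U(1)])
  have tr: "trace (max_mixed ** B) = trace B / of_real ?m" for B :: "complex^'m^'m"
    unfolding max_mixed_eq trace_def real_diag_mult_nth by (simp add: sum_divide_distrib)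
  have "trace (max_mixed ** matrix_fun ln max_mixed - max_mixed ** matrix_fun ln \<rho>)
      = of_real (ln (1 / ?m) - (\<Sum>i\<in>UNIV. ln (d i)) / ?m)"
    unfolding trace_sub tr lnm ln\<rho> trace_unitary_conj[OF U(1)] trace_real_diag by (simp add: o_def)
  then show ?thesis using ker True lndet by (simp add: rel_entropy_def ln_div)
qed

subsection \<open>Operations on the system and the reduced state\<close>

abbreviation joint_index :: "nat \<Rightarrow> ('m \<times> nat) set" where
  "joint_index n \<equiv> UNIV \<times> {..<n}"

text \<open>The matrix of \<open>A\<close> tensored with the identity of the environment.\<close>

definition lift_op :: "complex^'m^'m \<Rightarrow> 'm \<times> nat \<Rightarrow> 'm \<times> nat \<Rightarrow> complex" where
  "lift_op A p q = (if snd p = snd q then A $ fst p $ fst q else 0)"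

lemma reduced_state_nth: "reduced_state n \<psi> $ i $ j = (\<Sum>k<n. \<psi> (i, k) * cnj (\<psi> (j, k)))"
  by (simp add: reduced_state_def partial_trace_env_def pure_op_def)

lemma sum_joint_index: "(\<Sum>p\<in>joint_index n. f p) = (\<Sum>i\<in>UNIV. \<Sum>k<n. f (i, k))"
  by (simp add: sum.cartesian_product)

lemma op_apply_lift_op:
  fixes \<psi> :: "'m::finite \<times> nat \<Rightarrow> complex"
  assumes "k < n"
  shows "op_apply (joint_index n) (lift_op A) \<psi> (i, k) = (\<Sum>j\<in>UNIV. A $ i $ j * \<psi> (j, k))"
proof -
  have "op_apply (joint_index n) (lift_op A) \<psi> (i, k) = (\<Sum>p\<in>joint_index n. lift_op A (i, k) p * \<psi> p)"
    using assms by (simp add: op_apply_def)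
  also have "\<dots> = (\<Sum>j\<in>UNIV. \<Sum>l<n. if k = l then A $ i $ j * \<psi> (j, k) else 0)"
    unfolding sum_joint_index by (intro sum.cong refl) (auto simp: lift_op_def)
  also have "\<dots> = (\<Sum>j\<in>UNIV. A $ i $ j * \<psi> (j, k))"
    using assms by simp
  finally show ?thesis .
qed

lemma reduced_state_lift_op:
  fixes \<psi> :: "'m::finite \<times> nat \<Rightarrow> complex"
  shows "reduced_state n (op_apply (joint_index n) (lift_op A) \<psi>) = A ** reduced_state n \<psi> ** dagger A"
proof -
  have "reduced_state n (op_apply (joint_index n) (lift_op A) \<psi>) $ i $ j = (A ** reduced_state n \<psi> ** dagger A) $ i $ j" for i j
  proof -
    have "reduced_state n (op_apply (joint_index n) (lift_op A) \<psi>) $ i $ j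
        = (\<Sum>k<n. (\<Sum>r\<in>UNIV. A $ i $ r * \<psi> (r, k)) * (\<Sum>s\<in>UNIV. cnj (A $ j $ s) * cnj (\<psi> (s, k))))"
      by (simp add: reduced_state_nth op_apply_lift_op)
    also have "\<dots> = (\<Sum>k<n. \<Sum>s\<in>UNIV. \<Sum>r\<in>UNIV. A $ i $ r * \<psi> (r, k) * (cnj (A $ j $ s) * cnj (\<psi> (s, k))))"
      by (simp add: sum_product) (intro sum.cong refl sum.swap)
    also have "\<dots> = (\<Sum>s\<in>UNIV. \<Sum>r\<in>UNIV. \<Sum>k<n. A $ i $ r * \<psi> (r, k) * (cnj (A $ j $ s) * cnj (\<psi> (s, k))))"
      by (subst sum.swap) (intro sum.cong refl sum.swap)
    also have "\<dots> = (A ** reduced_state n \<psi> ** dagger A) $ i $ j"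
      by (simp add: matrix_matrix_mult_def dagger_def reduced_state_nth sum_distrib_left sum_distrib_right mult_ac)
    finally show ?thesis .
  qed
  then show ?thesis by (simp add: vec_eq_iff)
qed

lemma unitary_on_lift_op:
  fixes U :: "complex^'m^'m"
  assumes U: "unitary_mat U"
  shows "unitary_on (joint_index n) (lift_op U)"
proof -
  have 1: "(\<Sum>r\<in>joint_index n. cnj (lift_op U r p) * lift_op U r q) = (if p = q then 1 else 0)"
    if "p \<in> joint_index n" "q \<in> joint_index n" for p q
  proof -
    have "(\<Sum>r\<in>joint_index n. cnj (lift_op U r p) * lift_op U r q)
        = (\<Sum>i\<in>UNIV. \<Sum>k<n. if k = snd p then (if snd p = snd q then cnj (U $ i $ fst p) * U $ i $ fst q else 0) else 0)"
      unfolding sum_joint_index by (intro sum.cong refl) (auto simp: lift_op_def)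
    also have "\<dots> = (if snd p = snd q then (dagger U ** U) $ fst p $ fst q else 0)"
      using that by (auto simp: matrix_matrix_mult_def dagger_def)
    also have "\<dots> = (if p = q then 1 else 0)"
      unfolding unitary_matD(1)[OF U] by (auto simp: mat_def prod_eq_iff)
    finally show ?thesis .
  qed
  have 2: "(\<Sum>r\<in>joint_index n. lift_op U p r * cnj (lift_op U q r)) = (if p = q then 1 else 0)"
    if "p \<in> joint_index n" "q \<in> joint_index n" for p q
  proof -
    have "(\<Sum>r\<in>joint_index n. lift_op U p r * cnj (lift_op U q r))
        = (\<Sum>i\<in>UNIV. \<Sum>k<n. if k = snd p then (if snd p = snd q then U $ fst p $ i * cnj (U $ fst q $ i) else 0) else 0)"
      unfolding sum_joint_index by (intro sum.cong refl) (auto simp: lift_op_def)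
    also have "\<dots> = (if snd p = snd q then (U ** dagger U) $ fst p $ fst q else 0)"
      using that by (auto simp: matrix_matrix_mult_def dagger_def)
    also have "\<dots> = (if p = q then 1 else 0)"
      unfolding unitary_matD(2)[OF U] by (auto simp: mat_def prod_eq_iff)
    finally show ?thesis .
  qed
  show ?thesis unfolding unitary_on_def using 1 2 by blast
qed

text \<open>This joins the two descriptions of one map: as a dilation its effect on volume is known,
  as an operator on the system its effect on reduced states. It confines the volume estimates to
  diagonal matrices.\<close>

lemma scale_coords_eq_lift_op:
  fixes a :: "'m::finite \<Rightarrow> real"
  shows "scale_coords (joint_index n) (\<lambda>p. a (fst p)) \<psi> = op_apply (joint_index n) (lift_op (real_diag a)) \<psi>"
proof
  fix p
  have "(\<Sum>j\<in>UNIV. real_diag a $ i $ j * \<psi> (j, k)) = of_real (a i) * \<psi> (i, k)" for i k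
    by (subst sum.remove[of _ i]) (auto simp: real_diag_def)
  then show "scale_coords (joint_index n) (\<lambda>p. a (fst p)) \<psi> p = op_apply (joint_index n) (lift_op (real_diag a)) \<psi> p"
    by (cases p; cases "snd p < n") (auto simp: scale_coords_def op_apply_lift_op scaleR_conv_of_real, auto simp: op_apply_def)
qed

lemma trace_reduced_state:
  fixes \<psi> :: "'m::finite \<times> nat \<Rightarrow> complex"
  shows "trace (reduced_state n \<psi>) = of_real (norm_sq (joint_index n) \<psi>)"
  by (simp add: of_real_norm_sq sum_joint_index trace_def reduced_state_nth)

text \<open>The quadratic form at v is the sum over k of the squared moduli of the inner products of
  v with the system vectors \<open>\<psi> (_, k)\<close>.\<close>

lemma reduced_state_density:
  fixes \<psi> :: "'m::finite \<times> nat \<Rightarrow> complex"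
  assumes "\<psi> \<in> unit_vectors (joint_index n)"
  shows "reduced_state n \<psi> \<in> density_ops"
proof -
  have "psd (reduced_state n \<psi>)"
    unfolding psd_def
  proof
    fix v :: "complex^'m"
    have "(\<Sum>i\<in>UNIV. cnj (v $ i) * (reduced_state n \<psi> *v v) $ i)
        = (\<Sum>i\<in>UNIV. \<Sum>j\<in>UNIV. \<Sum>k<n. (cnj (v $ i) * \<psi> (i, k)) * cnj (cnj (v $ j) * \<psi> (j, k)))"
      by (simp add: matrix_vector_mult_def reduced_state_nth sum_distrib_left sum_distrib_right mult_ac)
    also have "\<dots> = (\<Sum>i\<in>UNIV. \<Sum>k<n. \<Sum>j\<in>UNIV. (cnj (v $ i) * \<psi> (i, k)) * cnj (cnj (v $ j) * \<psi> (j, k)))"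
      by (intro sum.cong refl sum.swap)
    also have "\<dots> = (\<Sum>k<n. \<Sum>i\<in>UNIV. \<Sum>j\<in>UNIV. (cnj (v $ i) * \<psi> (i, k)) * cnj (cnj (v $ j) * \<psi> (j, k)))"
      by (rule sum.swap)
    also have "\<dots> = (\<Sum>k<n. (\<Sum>i\<in>UNIV. cnj (v $ i) * \<psi> (i, k)) * cnj (\<Sum>j\<in>UNIV. cnj (v $ j) * \<psi> (j, k)))"
      by (simp add: sum_product)
    also have "\<dots> = of_real (\<Sum>k<n. (cmod (\<Sum>i\<in>UNIV. cnj (v $ i) * \<psi> (i, k)))\<^sup>2)"
      by (simp only: of_real_sum complex_norm_square)
    finally show "(\<Sum>i\<in>UNIV. cnj (v $ i) * (reduced_state n \<psi> *v v) $ i) \<in> \<real>\<^sub>\<ge>\<^sub>0"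
      by (simp only: nonneg_Reals_of_real_iff) (simp add: sum_nonneg)
  qed
  moreover have "trace (reduced_state n \<psi>) = 1"
    using assms by (simp add: trace_reduced_state mem_unit_vectors)
  ultimately show ?thesis by (simp add: density_ops_def)
qed

lemma reduced_state_vnormalize:
  fixes \<psi> :: "'m::finite \<times> nat \<Rightarrow> complex"
  shows "reduced_state n (vnormalize (joint_index n) \<psi>) = reduced_state n \<psi> /\<^sub>R norm_sq (joint_index n) \<psi>"
proof -
  have "complex_of_real (sqrt (norm_sq (joint_index n) \<psi>)) * of_real (sqrt (norm_sq (joint_index n) \<psi>)) = of_real (norm_sq (joint_index n) \<psi>)"
    by (simp flip: of_real_mult)
  then have *: "inverse (complex_of_real (sqrt (norm_sq (joint_index n) \<psi>))) * inverse (of_real (sqrt (norm_sq (joint_index n) \<psi>))) = inverse (of_real (norm_sq (joint_index n) \<psi>))"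
    by (metis inverse_mult_distrib)
  have "reduced_state n (vnormalize (joint_index n) \<psi>) $ i $ j = (reduced_state n \<psi> /\<^sub>R norm_sq (joint_index n) \<psi>) $ i $ j" for i j
    unfolding vector_scaleR_component reduced_state_nth
    by (simp add: vnormalize_def scaleR_conv_of_real *[symmetric] sum_distrib_left mult_ac)
  then show ?thesis by (simp add: vec_eq_iff)
qed

section \<open>Events determined by the reduced state\<close>

definition state_event :: "nat \<Rightarrow> (complex^'m^'m) set \<Rightarrow> ('m \<times> nat \<Rightarrow> complex) set" where
  "state_event n G = {\<psi> \<in> unit_vectors (joint_index n). reduced_state n \<psi> \<in> G}"

lemma measurable_reduced_state:
  "reduced_state n \<in> borel_measurable (sphere_algebra (joint_index n :: ('m::finite \<times> nat) set))"
proof -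
  \<comment> \<open>Elementary matrices: summing \<open>E i j\<close> over the entries of a matrix
    recovers it, which reduces measurability to the entries.\<close>
  define E :: "'m \<Rightarrow> 'm \<Rightarrow> complex \<Rightarrow> complex^'m^'m" where
    "E i j c = (\<chi> a b. if a = i \<and> b = j then c else 0)" for i j c
  have "continuous_on UNIV (E i j)" for i j
    unfolding E_def
  proof (intro continuous_on_vec_lambda)
    fix a b show "continuous_on UNIV (\<lambda>c::complex. if a = i \<and> b = j then c else 0)"
      by (cases "a = i \<and> b = j") auto
  qed
  then have E: "E i j \<in> borel_measurable borel" for i j
    by (rule borel_measurable_continuous_onI)
  have comp: "(\<lambda>\<psi>. \<psi> (i, k)) \<in> borel_measurable (sphere_algebra (joint_index n :: ('m \<times> nat) set))" if "k < n" for i k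
    using that by (intro sphere_component) auto
  have "(\<lambda>\<psi>. reduced_state n \<psi> $ i $ j) \<in> borel_measurable (sphere_algebra (joint_index n :: ('m \<times> nat) set))" for i j
    unfolding reduced_state_nth
    by (intro borel_measurable_sum borel_measurable_times comp
        measurable_compose[OF comp borel_measurable_continuous_onI[OF continuous_on_cnj[OF continuous_on_id]]]) auto
  then have "(\<lambda>\<psi>. \<Sum>i\<in>UNIV. \<Sum>j\<in>UNIV. E i j (reduced_state n \<psi> $ i $ j)) \<in> borel_measurable (sphere_algebra (joint_index n :: ('m \<times> nat) set))"
    by (intro borel_measurable_sum measurable_compose[OF _ E])
  moreover have "(\<Sum>i\<in>UNIV. \<Sum>j\<in>UNIV. E i j (A $ i $ j)) = A" for A
  proof -
    have "(\<Sum>i\<in>UNIV. \<Sum>j\<in>UNIV. E i j (A $ i $ j)) $ a $ b = A $ a $ b" for a b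
    proof -
      have "(\<Sum>i\<in>UNIV. \<Sum>j\<in>UNIV. E i j (A $ i $ j)) $ a $ b = (\<Sum>i\<in>UNIV. \<Sum>j\<in>UNIV. if i = a then if j = b then A $ a $ b else 0 else 0)"
        by (simp add: E_def) (intro sum.cong refl, auto)
      also have "\<dots> = (\<Sum>i\<in>UNIV. if i = a then A $ a $ b else 0)" by (intro sum.cong refl) auto
      finally show ?thesis by simp
    qed
    then show ?thesis by (simp add: vec_eq_iff)
  qed
  ultimately show ?thesis by simp
qed

lemma sets_state_event:
  fixes G :: "(complex^'m^'m) set"
  assumes "open G" shows "state_event n G \<in> sets (sphere_algebra (joint_index n))"
proof -
  have "state_event n G = reduced_state n -` G \<inter> space (sphere_algebra (joint_index n))"
    by (auto simp: state_event_def)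
  then show ?thesis using measurable_sets[OF measurable_reduced_state borel_open[OF assms]] by simp
qed

lemma norm_matrix_le:
  fixes A :: "complex^'m^'m"
  assumes "\<And>i j. cmod (A $ i $ j) \<le> e"
  shows "norm A \<le> (real CARD('m))\<^sup>2 * e"
proof -
  have "norm A \<le> (\<Sum>i\<in>UNIV. norm (A $ i))" unfolding norm_vec_def[of A] by (rule L2_set_le_sum) simp
  also have "\<dots> \<le> (\<Sum>i\<in>UNIV. \<Sum>j\<in>UNIV. cmod (A $ i $ j))"
    unfolding norm_vec_def[of "A $ _"] by (intro sum_mono L2_set_le_sum) simp
  also have "\<dots> \<le> (\<Sum>i\<in>(UNIV::'m set). \<Sum>j\<in>(UNIV::'m set). e)" by (intro sum_mono assms)
  finally show ?thesis by (simp add: power2_eq_square mult_ac)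
qed

lemma state_event_sphere_open:
  fixes G :: "(complex^'m^'m) set"
  assumes G: "open G" and \<psi>: "\<psi> \<in> state_event n G"
  shows "\<exists>r>0. sphere_cap (joint_index n) \<psi> r \<subseteq> state_event n G"
proof -
  let ?I = "joint_index n :: ('m \<times> nat) set"
  obtain e where e: "e > 0" "\<And>\<sigma>. dist \<sigma> (reduced_state n \<psi>) < e \<Longrightarrow> \<sigma> \<in> G"
    using G \<psi> by (auto simp: state_event_def open_dist)
  \<comment> \<open>Coordinates of unit vectors have modulus at most 1, so a coordinate change of at
    most s moves each entry of the reduced state by at most 2 n s, and the matrix norm costs a
    further factor m^2. Dividing by c + 1 gives strict inequality even if c = 0; the cap radius is
    s^2 because \<open>dist_sq\<close> is a square.\<close>
  define c where "c = (real CARD('m))\<^sup>2 * (2 * real n)"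
  have c: "c \<ge> 0" by (simp add: c_def)
  define s where "s = e / (c + 1)"
  have s: "s > 0" "c * s < e" using e c by (simp_all add: s_def field_simps)
  have "sphere_cap ?I \<psi> (s\<^sup>2) \<subseteq> state_event n G"
  proof
    fix \<phi> assume "\<phi> \<in> sphere_cap ?I \<psi> (s\<^sup>2)"
    then have \<phi>: "\<phi> \<in> unit_vectors ?I" "dist_sq ?I \<psi> \<phi> < s\<^sup>2" by (auto simp: sphere_cap_def)
    have le1: "cmod (x p) \<le> 1" if "x \<in> unit_vectors ?I" "p \<in> ?I" for x p
    proof -
      have "(cmod (x p))\<^sup>2 \<le> norm_sq ?I x" unfolding norm_sq_def using that by (intro member_le_sum) auto
      then have "(cmod (x p))\<^sup>2 \<le> 1\<^sup>2" using that by (simp add: mem_unit_vectors)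
      then show ?thesis by (rule power2_le_imp_le) simp
    qed
    have diff: "cmod (\<phi> p - \<psi> p) \<le> s" if "p \<in> ?I" for p
    proof -
      have "(cmod (\<phi> p - \<psi> p))\<^sup>2 \<le> dist_sq ?I \<phi> \<psi>" unfolding dist_sq_def using that by (intro member_le_sum) auto
      then have "(cmod (\<phi> p - \<psi> p))\<^sup>2 \<le> s\<^sup>2" using \<phi>(2) by (simp add: dist_sq_commute)
      then show ?thesis by (rule power2_le_imp_le) (use s in simp)
    qed
    have \<psi>1: "\<psi> \<in> unit_vectors ?I" using \<psi> by (simp add: state_event_def)
    have "cmod ((reduced_state n \<phi> - reduced_state n \<psi>) $ i $ j) \<le> 2 * real n * s" for i j
    proof -
      have "(reduced_state n \<phi> - reduced_state n \<psi>) $ i $ j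
          = (\<Sum>k<n. (\<phi> (i, k) - \<psi> (i, k)) * cnj (\<phi> (j, k)) + \<psi> (i, k) * cnj (\<phi> (j, k) - \<psi> (j, k)))"
        by (simp add: reduced_state_nth sum_subtractf[symmetric] algebra_simps)
      also have "cmod \<dots> \<le> (\<Sum>k<n. s * 1 + 1 * s)"
      proof (intro order_trans[OF norm_sum] sum_mono order_trans[OF norm_triangle_ineq] add_mono)
        fix k assume k: "k \<in> {..<n}"
        show "cmod ((\<phi> (i, k) - \<psi> (i, k)) * cnj (\<phi> (j, k))) \<le> s * 1"
          unfolding norm_mult complex_mod_cnj using k s by (intro mult_mono diff le1 \<phi>) auto
        show "cmod (\<psi> (i, k) * cnj (\<phi> (j, k) - \<psi> (j, k))) \<le> 1 * s"
          unfolding norm_mult complex_mod_cnj using k s by (intro mult_mono diff le1 \<psi>1) auto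
      qed
      finally show ?thesis by simp
    qed
    then have "dist (reduced_state n \<phi>) (reduced_state n \<psi>) \<le> c * s"
      using norm_matrix_le[of "reduced_state n \<phi> - reduced_state n \<psi>" "2 * real n * s"] by (simp add: dist_norm c_def mult_ac)
    then show "\<phi> \<in> state_event n G"
      using e(2) s \<phi>(1) by (simp add: state_event_def)
  qed
  then show ?thesis using s by (intro exI[of _ "s\<^sup>2"]) auto
qed

definition state_prob :: "('m \<times> nat \<Rightarrow> complex) measure \<Rightarrow> nat \<Rightarrow> (complex^'m^'m) set \<Rightarrow> real" where
  "state_prob M n G = measure M (state_event n G)"

text \<open>The volume inequality, restated for states and a diagonal matrix. The squared norm of
  the dilated vector is the trace of the transformed state, and each \<open>a i\<close> occurs once
  for every environment index.\<close>

lemma state_prob_scale: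
  fixes G N :: "(complex^'m^'m) set"
  assumes M: "unitarily_invariant_prob (joint_index n) M" and n: "n \<ge> 1" and N: "open N" and G: "open G"
    and a: "\<And>i. a i > 0" and t: "t > 0"
    and bound: "\<And>\<rho>. \<rho> \<in> density_ops \<Longrightarrow> \<rho> \<in> N \<Longrightarrow> Re (trace (real_diag a ** \<rho> ** real_diag a)) \<le> t"
    and image: "\<And>\<rho>. \<rho> \<in> density_ops \<Longrightarrow> \<rho> \<in> N \<Longrightarrow>
      (real_diag a ** \<rho> ** real_diag a) /\<^sub>R Re (trace (real_diag a ** \<rho> ** real_diag a)) \<in> G"
  shows "state_prob M n N * (\<Prod>i\<in>UNIV. (a i)\<^sup>2) ^ n \<le> (t ^ CARD('m)) ^ n * state_prob M n G"
proof -
  let ?I = "joint_index n :: ('m \<times> nat) set" and ?S = "scale_coords (joint_index n) (\<lambda>p. a (fst p))"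
  have "(undefined, 0) \<in> ?I" using n by simp
  then have I: "finite ?I" "?I \<noteq> {}" by (simp, blast)
  have red: "reduced_state n (?S \<psi>) = real_diag a ** reduced_state n \<psi> ** real_diag a" for \<psi>
    by (simp add: scale_coords_eq_lift_op reduced_state_lift_op)
  have nrm: "norm_sq ?I (?S \<psi>) = Re (trace (real_diag a ** reduced_state n \<psi> ** real_diag a))" for \<psi>
    using trace_reduced_state[of n "?S \<psi>"] by (simp add: red)
  have le: "norm_sq ?I (?S \<psi>) \<le> t" if "\<psi> \<in> state_event n N" for \<psi>
    unfolding nrm using that reduced_state_density by (intro bound) (auto simp: state_event_def)
  have img: "vnormalize ?I (?S \<psi>) \<in> state_event n G" if \<psi>: "\<psi> \<in> state_event n N" for \<psi>
  proof -
    have \<rho>: "reduced_state n \<psi> \<in> density_ops" "reduced_state n \<psi> \<in> N"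
      using \<psi> reduced_state_density by (auto simp: state_event_def)
    have \<psi>1: "norm_sq ?I \<psi> = 1" using \<psi> by (simp add: state_event_def mem_unit_vectors)
    have "\<exists>p\<in>?I. \<psi> p \<noteq> 0"
    proof (rule ccontr)
      assume "\<not> ?thesis"
      then have "norm_sq ?I \<psi> = 0" unfolding norm_sq_def by (intro sum.neutral) auto
      then show False using \<psi>1 by simp
    qed
    then obtain p where p: "p \<in> ?I" "\<psi> p \<noteq> 0" by blast
    have "(cmod (?S \<psi> p))\<^sup>2 > 0" using p a[of "fst p"] by (simp add: scale_coords_def less_imp_neq[symmetric])
    also have "(cmod (?S \<psi> p))\<^sup>2 \<le> norm_sq ?I (?S \<psi>)" unfolding norm_sq_def
      using p I by (intro member_le_sum) auto
    finally have "vnormalize ?I (?S \<psi>) \<in> unit_vectors ?I" by (rule vnormalize_unit)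
    then show ?thesis
      using image[OF \<rho>] by (simp add: state_event_def reduced_state_vnormalize red nrm)
  qed
  have "measure M (state_event n N) * (\<Prod>p\<in>?I. (a (fst p))\<^sup>2) \<le> t ^ card ?I * measure M (state_event n G)"
    using a t le img
    by (intro sphere_scale_bound[OF M I sets_state_event[OF N] state_event_sphere_open[OF N]
          sets_state_event[OF G] state_event_sphere_open[OF G]]) auto
  moreover have "(\<Prod>p\<in>?I. (a (fst p))\<^sup>2) = (\<Prod>i\<in>UNIV. (a i)\<^sup>2) ^ n"
    using prod.cartesian_product[of "\<lambda>i k. (a i)\<^sup>2" "{..<n}" UNIV]
    by (simp add: case_prod_beta prod_power_distrib)
  ultimately show ?thesis
    by (simp add: state_prob_def power_mult card_cartesian_product)
qed

text \<open>\<open>lift_op U\<close> preserves the measure and conjugates the reduced state by U, so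
  each estimate may be made in an eigenbasis.\<close>

lemma state_prob_unitary:
  fixes G :: "(complex^'m^'m) set"
  assumes M: "unitarily_invariant_prob (joint_index n) M" and G: "open G" and U: "unitary_mat U"
  shows "state_prob M n {\<rho>. U ** \<rho> ** dagger U \<in> G} = state_prob M n G"
proof -
  let ?I = "joint_index n :: ('m \<times> nat) set"
  have "op_apply ?I (lift_op U) -` state_event n G \<inter> unit_vectors ?I = state_event n {\<rho>. U ** \<rho> ** dagger U \<in> G}"
    using op_apply_unit_vectors[OF _ unitary_on_lift_op[OF U]]
    by (auto simp: state_event_def reduced_state_lift_op)
  then show ?thesis
    using emeasure_op_apply_vimage[OF M _ unitary_on_lift_op[OF U], of "state_event n G"] sets_state_event[OF G]
      unitarily_invariant_probD(2)[OF M]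
    by (simp add: state_prob_def measure_def)
qed

lemma continuous_on_matrix_mult:
  fixes f :: "'a::topological_space \<Rightarrow> complex^'n^'m" and g :: "'a \<Rightarrow> complex^'k^'n"
  assumes "continuous_on S f" "continuous_on S g"
  shows "continuous_on S (\<lambda>x. f x ** g x)"
  unfolding matrix_matrix_mult_def using assms
  by (intro continuous_on_vec_lambda continuous_intros)

lemma continuous_on_trace:
  fixes f :: "'a::topological_space \<Rightarrow> complex^'m^'m"
  assumes "continuous_on S f" shows "continuous_on S (\<lambda>x. trace (f x))"
  unfolding trace_def using assms by (intro continuous_intros)

lemma continuous_on_det:
  fixes f :: "'a::topological_space \<Rightarrow> complex^'m^'m"
  assumes "continuous_on S f" shows "continuous_on S (\<lambda>x. det (f x))"
  unfolding det_def using assms by (intro continuous_intros)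

text \<open>In the eigenbasis the dilation with a = sqrt b turns the trace against
  \<open>real_diag b\<close> into the squared norm of the dilated vector. No constraint is put on
  the image, whose probability is bounded by 1.\<close>

lemma state_prob_halfspace:
  fixes U :: "complex^'m^'m"
  assumes M: "unitarily_invariant_prob (joint_index n) M" and n: "n \<ge> 1" and U: "unitary_mat U"
    and b: "\<And>i. b i > 0" and c: "c > 0"
  shows "state_prob M n {\<rho>. Re (trace (U ** real_diag b ** dagger U ** \<rho>)) < c} \<le> (c ^ CARD('m) / (\<Prod>i\<in>UNIV. b i)) ^ n"
proof -
  interpret prob_space M using M by (simp add: unitarily_invariant_prob_def)
  let ?V = "{\<rho> :: complex^'m^'m. Re (trace (U ** real_diag b ** dagger U ** \<rho>)) < c}"
  let ?N = "{\<rho>. U ** \<rho> ** dagger U \<in> ?V}" and ?a = "\<lambda>i. sqrt (b i)"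
  have openV: "open ?V"
    by (intro open_Collect_less continuous_intros continuous_on_trace continuous_on_matrix_mult)
  have openN: "open ?N"
    unfolding mem_Collect_eq
    by (intro open_Collect_less continuous_intros continuous_on_trace continuous_on_matrix_mult)
  have aa: "real_diag ?a ** real_diag ?a = real_diag b"
    using b by (simp add: real_diag_mult less_imp_le)
  have tr: "trace (real_diag ?a ** \<rho> ** real_diag ?a) = trace (U ** real_diag b ** dagger U ** (U ** \<rho> ** dagger U))" for \<rho>
  proof -
    have "trace (real_diag ?a ** \<rho> ** real_diag ?a) = trace (real_diag ?a ** real_diag ?a ** \<rho>)"
      by (subst trace_mul_sym) (simp add: matrix_mul_assoc)
    also have "\<dots> = trace (U ** (real_diag b ** \<rho>) ** dagger U)"
      by (simp add: aa U)
    finally show ?thesis by (simp add: conj_mult U)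
  qed
  have "state_prob M n ?N * (\<Prod>i\<in>UNIV. (?a i)\<^sup>2) ^ n \<le> (c ^ CARD('m)) ^ n * state_prob M n UNIV"
    using b c by (intro state_prob_scale[OF M n openN]) (auto simp: tr less_imp_le)
  also have "\<dots> \<le> (c ^ CARD('m)) ^ n"
    using c prob_le_1 by (simp add: state_prob_def mult_left_le)
  finally have "state_prob M n ?V * (\<Prod>i\<in>UNIV. b i) ^ n \<le> (c ^ CARD('m)) ^ n"
    using b by (simp add: state_prob_unitary[OF M openV U, simplified] less_imp_le)
  moreover have "(\<Prod>i\<in>UNIV. b i) > 0" using b by (intro prod_pos) auto
  ultimately show ?thesis
    by (simp add: power_divide field_simps)
qed

subsection \<open>Exponential bounds\<close>

text \<open>On states this is exp(- m D(\<pi> || \<rho>)), with value 0 where D is infinite. Unlike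
  D it is real-valued and continuous everywhere.\<close>

definition scaled_det :: "complex^'m^'m \<Rightarrow> real" where
  "scaled_det \<rho> = real CARD('m) ^ CARD('m) * Re (det \<rho>)"

lemma scaled_det_diagonalised:
  fixes U :: "complex^'m^'m"
  assumes "unitary_mat U"
  shows "scaled_det (U ** real_diag d ** dagger U) = (\<Prod>i\<in>UNIV. real CARD('m) * d i)"
  unfolding scaled_det_def det_diagonalised[OF assms] Re_complex_of_real by (simp add: prod.distrib)

lemma continuous_on_scaled_det: "continuous_on S (scaled_det :: complex^'m^'m \<Rightarrow> real)"
  unfolding scaled_det_def[abs_def] by (intro continuous_intros continuous_on_det)

text \<open>The neighbourhood is an open half-space containing \<rho>. The shift by \<delta> makes
  the matrix invertible for singular \<rho>, and \<rho> is strictly inside because the sum of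
  \<open>d i / (d i + \<delta>)\<close> is at most m.\<close>

lemma state_prob_local_upper:
  fixes \<rho> :: "complex^'m^'m"
  assumes \<rho>: "\<rho> \<in> density_ops" and x: "scaled_det \<rho> < x"
  shows "\<exists>V. open V \<and> \<rho> \<in> V \<and> (\<forall>n\<ge>1. \<forall>M. unitarily_invariant_prob (joint_index n) M \<longrightarrow> state_prob M n V \<le> x ^ n)"
proof -
  let ?m = "real CARD('m)"
  obtain U d where U: "unitary_mat U" "\<rho> = U ** real_diag d ** dagger U" and d: "\<And>i. d i \<ge> 0"
    using density_diagonalised[OF \<rho>] by blast
  \<comment> \<open>The base of the exponential bound that \<open>state_prob_halfspace\<close> gives
    for the shift \<delta>; it tends to \<open>scaled_det \<rho>\<close> as \<delta> decreases to
    0.\<close>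
  define f where "f \<delta> = (?m + \<delta>) ^ CARD('m) * (\<Prod>i\<in>UNIV. d i + \<delta>)" for \<delta> :: real
  have "(f \<longlongrightarrow> (?m + 0) ^ CARD('m) * (\<Prod>i\<in>UNIV. d i + 0)) (at_right 0)"
    unfolding f_def by (intro tendsto_intros)
  moreover have "(?m + 0) ^ CARD('m) * (\<Prod>i\<in>UNIV. d i + 0) < x"
    using x by (simp add: U(2) scaled_det_diagonalised[OF U(1)] prod.distrib)
  ultimately have "eventually (\<lambda>\<delta>. f \<delta> < x) (at_right 0)"
    by (rule order_tendstoD(2))
  moreover have "eventually (\<lambda>\<delta>::real. \<delta> > 0) (at_right 0)"
    by (rule eventually_at_right_less)
  ultimately have "eventually (\<lambda>\<delta>. f \<delta> < x \<and> \<delta> > 0) (at_right 0)"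
    by eventually_elim simp
  then obtain \<delta> where \<delta>: "f \<delta> < x" "\<delta> > 0"
    using eventually_happens'[OF trivial_limit_at_right_real] by blast
  define b where "b i = 1 / (d i + \<delta>)" for i
  have d\<delta>: "d i + \<delta> > 0" for i using d[of i] \<delta> by simp
  then have b: "b i > 0" for i by (simp add: b_def)
  let ?V = "{\<sigma>. Re (trace (U ** real_diag b ** dagger U ** \<sigma>)) < ?m + \<delta>}"
  have "open ?V"
    by (intro open_Collect_less continuous_intros continuous_on_trace continuous_on_matrix_mult)
  moreover have "\<rho> \<in> ?V"
  proof -
    have "Re (trace (U ** real_diag b ** dagger U ** \<rho>)) = (\<Sum>i\<in>UNIV. b i * d i)"
      by (simp add: U conj_mult real_diag_mult)
    also have "\<dots> \<le> (\<Sum>i\<in>(UNIV::'m set). 1)"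
      using d d\<delta> \<delta> by (intro sum_mono) (simp add: b_def)
    finally show ?thesis using \<delta> by simp
  qed
  moreover have "state_prob M n ?V \<le> x ^ n" if "n \<ge> 1" "unitarily_invariant_prob (joint_index n) M" for n M
  proof -
    have "state_prob M n ?V \<le> ((?m + \<delta>) ^ CARD('m) / (\<Prod>i\<in>UNIV. b i)) ^ n"
      using \<delta> by (intro state_prob_halfspace that U(1) b) (simp add: add_nonneg_pos)
    also have "(?m + \<delta>) ^ CARD('m) / (\<Prod>i\<in>UNIV. b i) = f \<delta>"
      by (simp add: f_def b_def prod_dividef)
    also have "f \<delta> ^ n \<le> x ^ n"
    proof (intro power_mono)
      have "?m + \<delta> > 0" using \<delta> by (simp add: add_nonneg_pos)
      then have "f \<delta> > 0" unfolding f_def using d\<delta> by (intro mult_pos_pos zero_less_power prod_pos) auto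
      then show "0 \<le> f \<delta>" by simp
    qed (use \<delta> in simp)
    finally show ?thesis .
  qed
  ultimately show ?thesis by blast
qed

text \<open>A finite subcover by the local half-spaces, with \<open>C\<close> its cardinality.
  Neither \<open>W\<close> nor \<open>C\<close> depends on n or M, so \<open>C\<close> has no effect
  on the exponential rate.\<close>

lemma state_prob_compact_upper:
  fixes K :: "(complex^'m^'m) set"
  assumes K: "compact K" "K \<subseteq> density_ops" and x: "\<And>\<rho>. \<rho> \<in> K \<Longrightarrow> scaled_det \<rho> < x"
  shows "\<exists>W C. open W \<and> K \<subseteq> W \<and> (\<forall>n\<ge>1. \<forall>M. unitarily_invariant_prob (joint_index n) M \<longrightarrow> state_prob M n W \<le> real C * x ^ n)"
proof -
  have "\<forall>\<rho>\<in>K. \<exists>V. open V \<and> \<rho> \<in> V \<and> (\<forall>n\<ge>1. \<forall>M. unitarily_invariant_prob (joint_index n) M \<longrightarrow> state_prob M n V \<le> x ^ n)"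
    using K(2) x by (intro ballI state_prob_local_upper) auto
  then obtain V where V: "\<And>\<rho>. \<rho> \<in> K \<Longrightarrow> open (V \<rho>)" "\<And>\<rho>. \<rho> \<in> K \<Longrightarrow> \<rho> \<in> V \<rho>"
    and V_le: "\<And>\<rho> n M. \<rho> \<in> K \<Longrightarrow> n \<ge> 1 \<Longrightarrow> unitarily_invariant_prob (joint_index n) M \<Longrightarrow> state_prob M n (V \<rho>) \<le> x ^ n"
    unfolding bchoice_iff by blast
  have "K \<subseteq> (\<Union>\<rho>\<in>K. V \<rho>)" using V(2) by blast
  then obtain F where F: "F \<subseteq> K" "finite F" "K \<subseteq> (\<Union>\<rho>\<in>F. V \<rho>)"
    using compactE_image[OF K(1), of K V] V(1) by metis
  have "state_prob M n (\<Union>\<rho>\<in>F. V \<rho>) \<le> real (card F) * x ^ n"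
    if n: "n \<ge> 1" and M: "unitarily_invariant_prob (joint_index n) M" for n M
  proof -
    interpret prob_space M using M by (simp add: unitarily_invariant_prob_def)
    have "state_event n (\<Union>\<rho>\<in>F. V \<rho>) = (\<Union>\<rho>\<in>F. state_event n (V \<rho>))" by (auto simp: state_event_def)
    then have "state_prob M n (\<Union>\<rho>\<in>F. V \<rho>) \<le> (\<Sum>\<rho>\<in>F. state_prob M n (V \<rho>))"
      unfolding state_prob_def
      using finite_measure_subadditive_finite[OF F(2), of "\<lambda>\<rho>. state_event n (V \<rho>)"] F(1) V(1)
        sets_state_event unitarily_invariant_probD(2)[OF M] by fastforce
    also have "\<dots> \<le> (\<Sum>\<rho>\<in>F. x ^ n)" using F(1) by (intro sum_mono V_le n M) auto
    finally show ?thesis by simp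
  qed
  moreover have "open (\<Union>\<rho>\<in>F. V \<rho>)" using F(1) V(1) by blast
  ultimately show ?thesis using F(3) by blast
qed

text \<open>AM-GM for the numbers m * d i, whose mean is 1, by summing ln y \<le> y - 1. Equality
  needs all of them to equal 1, and then \<rho> is maximally mixed.\<close>

lemma scaled_det_less_1:
  fixes \<rho> :: "complex^'m^'m"
  assumes \<rho>: "\<rho> \<in> density_ops" "\<rho> \<noteq> max_mixed"
  shows "scaled_det \<rho> < 1"
proof -
  let ?m = "real CARD('m)"
  obtain U d where U: "unitary_mat U" "\<rho> = U ** real_diag d ** dagger U" and d: "\<And>i. d i \<ge> 0" and sum: "(\<Sum>i\<in>UNIV. d i) = 1"
    using density_diagonalised[OF \<rho>(1)] by blast
  have sd: "scaled_det \<rho> = (\<Prod>i\<in>UNIV. ?m * d i)" by (simp only: U(2) scaled_det_diagonalised[OF U(1)])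
  show ?thesis
  proof (cases "\<exists>i. d i = 0")
    case True
    then have "(\<Prod>i\<in>UNIV. ?m * d i) = 0" by auto
    then show ?thesis unfolding sd by linarith
  next
    case False
    then have pos: "?m * d i > 0" for i using d[of i] by (simp add: order_less_le)
    have "\<exists>i. ?m * d i \<noteq> 1"
    proof (rule ccontr)
      assume "\<not> ?thesis"
      then have "d = (\<lambda>_. 1 / ?m)" by (auto simp: field_simps)
      then have "real_diag d = (max_mixed :: complex^'m^'m)"
        by (simp add: max_mixed_eq)
      then have "\<rho> = U ** (mat 1 /\<^sub>R ?m) ** dagger U" by (simp add: U(2) max_mixed_def)
      also have "\<dots> = (U ** dagger U) /\<^sub>R ?m"
        by (simp add: vec_eq_iff matrix_matrix_mult_def mat_def if_distrib if_distribR scaleR_sum_right cong: if_cong)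
      also have "\<dots> = max_mixed" by (simp add: unitary_matD(2)[OF U(1)] max_mixed_def)
      finally show False using \<rho>(2) by simp
    qed
    then obtain k where k: "?m * d k \<noteq> 1" by blast
    have "ln (scaled_det \<rho>) = (\<Sum>i\<in>UNIV. ln (?m * d i))"
      unfolding sd using False by (intro ln_prod) auto
    also have "\<dots> < (\<Sum>i\<in>UNIV. ?m * d i - 1)"
    proof (rule sum_strict_mono_ex1)
      show "\<forall>i\<in>UNIV. ln (?m * d i) \<le> ?m * d i - 1" using ln_le_minus_one[OF pos] by blast
      show "\<exists>i\<in>UNIV. ln (?m * d i) < ?m * d i - 1"
        using ln_eq_minus_one[OF pos, of k] k ln_le_minus_one[OF pos, of k] by (intro bexI[of _ k]) (auto simp: order_less_le)
    qed simp
    also have "\<dots> = 0" by (simp add: sum_subtractf sum_distrib_left[symmetric] sum)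
    finally have "ln (scaled_det \<rho>) < 0" .
    moreover have "scaled_det \<rho> > 0" unfolding sd using pos by (intro prod_pos) auto
    ultimately show ?thesis using ln_ge_zero linorder_not_le by metis
  qed
qed

text \<open>On the compact complement of N the maximum of \<open>scaled_det\<close> is attained,
  hence below 1, so the complement has exponentially small probability. The constant 1/2 stands for
  any fixed bound below 1.\<close>

lemma state_prob_concentration:
  fixes N :: "(complex^'m^'m) set"
  assumes N: "open N" "max_mixed \<in> N"
  shows "\<exists>n0. \<forall>n\<ge>n0. \<forall>M. n \<ge> 1 \<longrightarrow> unitarily_invariant_prob (joint_index n) M \<longrightarrow> 1 / 2 \<le> state_prob M n N"
proof -
  define K where "K = density_ops - N"
  have K: "compact K" "K \<subseteq> density_ops"
    unfolding K_def using compact_diff[OF compact_density_ops N(1)] by auto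
  have lt: "scaled_det \<rho> < 1" if "\<rho> \<in> K" for \<rho>
    using that N(2) by (intro scaled_det_less_1) (auto simp: K_def)
  obtain x where x: "0 < x" "x < 1" "\<And>\<rho>. \<rho> \<in> K \<Longrightarrow> scaled_det \<rho> < x"
  proof (cases "K = {}")
    case True
    then show ?thesis using that[of "1 / 2"] by simp
  next
    case False
    obtain \<rho>0 where \<rho>0: "\<rho>0 \<in> K" "\<And>\<rho>. \<rho> \<in> K \<Longrightarrow> scaled_det \<rho> \<le> scaled_det \<rho>0"
      using continuous_attains_sup[OF K(1) False continuous_on_scaled_det] by blast
    have "max 0 (scaled_det \<rho>0) < 1" using lt[OF \<rho>0(1)] by simp
    then obtain y where y: "max 0 (scaled_det \<rho>0) < y" "y < 1" using dense by blast
    then show ?thesis using that[of y] \<rho>0(2) by fastforce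
  qed
  obtain W C where W: "open W" "K \<subseteq> W"
    and W_le: "\<And>n M. n \<ge> 1 \<Longrightarrow> unitarily_invariant_prob (joint_index n) M \<Longrightarrow> state_prob M n W \<le> real C * x ^ n"
    using state_prob_compact_upper[OF K x(3)] by blast
  have "(\<lambda>n. real C * x ^ n) \<longlonglongrightarrow> real C * 0"
    using x by (intro tendsto_mult tendsto_const LIMSEQ_power_zero) simp
  then have "eventually (\<lambda>n. real C * x ^ n < 1 / 2) sequentially"
    by (rule order_tendstoD) simp
  then obtain n0 where n0: "\<And>n. n \<ge> n0 \<Longrightarrow> real C * x ^ n < 1 / 2"
    unfolding eventually_sequentially by blast
  have "1 / 2 \<le> state_prob M n N" if n: "n \<ge> n0" "n \<ge> 1" and M: "unitarily_invariant_prob (joint_index n) M" for n M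
  proof -
    interpret prob_space M using M by (simp add: unitarily_invariant_prob_def)
    have s: "state_event n N \<in> sets M" "state_event n W \<in> sets M"
      using sets_state_event N(1) W(1) unitarily_invariant_probD(2)[OF M] by auto
    have "space M \<subseteq> state_event n N \<union> state_event n W"
      using reduced_state_density W(2) by (auto simp: unitarily_invariant_probD(3)[OF M] state_event_def K_def)
    then have "1 \<le> prob (state_event n N \<union> state_event n W)"
      using finite_measure_mono[of "space M" "state_event n N \<union> state_event n W"] s prob_space by auto
    also have "\<dots> \<le> state_prob M n N + state_prob M n W"
      unfolding state_prob_def by (rule measure_Un_le) (use s in auto)
    finally show ?thesis using W_le[OF n(2) M] n0[OF n(1)] by simp
  qed
  then show ?thesis by blast
qed

text \<open>The dilation moves the bulk of the measure, which sits near the maximally mixed state,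
  to a neighbourhood of \<rho>. The slack t > 1 allows a whole neighbourhood to be moved and costs
  the factor t^(-mn).\<close>

lemma state_prob_local_lower:
  fixes \<rho> :: "complex^'m^'m"
  assumes \<rho>: "\<rho> \<in> density_ops" "scaled_det \<rho> > 0" and G: "open G" "\<rho> \<in> G" and t: "t > 1"
  shows "\<exists>n0. \<forall>n\<ge>n0. \<forall>M. n \<ge> 1 \<longrightarrow> unitarily_invariant_prob (joint_index n) M \<longrightarrow>
    (scaled_det \<rho> / t ^ CARD('m)) ^ n / 2 \<le> state_prob M n G"
proof -
  let ?m = "real CARD('m)"
  obtain U d where U: "unitary_mat U" "\<rho> = U ** real_diag d ** dagger U" and d0: "\<And>i. d i \<ge> 0" and sum: "(\<Sum>i\<in>UNIV. d i) = 1"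
    using density_diagonalised[OF \<rho>(1)] by blast
  have sd: "scaled_det \<rho> = (\<Prod>i\<in>UNIV. ?m * d i)" by (simp only: U(2) scaled_det_diagonalised[OF U(1)])
  have "d i \<noteq> 0" for i
  proof
    assume "d i = 0"
    then have "(\<Prod>i\<in>UNIV. ?m * d i) = 0" by auto
    then show False using \<rho>(2) unfolding sd by linarith
  qed
  then have d: "d i > 0" for i using d0[of i] by (simp add: order_less_le)
  \<comment> \<open>With these weights the maximally mixed state goes exactly to
    \<open>real_diag d\<close>, already of trace 1, and the squares multiply to
    \<open>scaled_det \<rho>\<close>.\<close>
  define a where "a i = sqrt (?m * d i)" for i
  have a: "a i > 0" for i using d by (simp add: a_def)
  have a2: "(a i)\<^sup>2 = ?m * d i" for i using d[of i] by (simp add: a_def)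
  let ?A = "real_diag a :: complex^'m^'m"
  define G' where "G' = {\<sigma>. U ** \<sigma> ** dagger U \<in> G}"
  define \<tau> where "\<tau> \<sigma> = Re (trace (?A ** \<sigma> ** ?A))" for \<sigma>
  define h where "h \<sigma> = (?A ** \<sigma> ** ?A) /\<^sub>R \<tau> \<sigma>" for \<sigma>
  have "continuous_on UNIV (\<lambda>\<sigma>. U ** \<sigma> ** dagger U)"
    by (intro continuous_intros continuous_on_matrix_mult)
  then have openG': "open G'"
    unfolding G'_def using open_vimage[OF G(1)] by (simp add: vimage_def)
  have cont\<tau>: "continuous_on S \<tau>" for S
    unfolding \<tau>_def by (intro continuous_intros continuous_on_trace continuous_on_matrix_mult)
  \<comment> \<open>Positivity of \<open>\<tau>\<close> keeps the normalisation in \<open>h\<close>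
    continuous; the bound by t is the norm hypothesis of \<open>state_prob_scale\<close>.\<close>
  define N0 where "N0 = {\<sigma>. 0 < \<tau> \<sigma>} \<inter> {\<sigma>. \<tau> \<sigma> < t}"
  have openN0: "open N0"
    unfolding N0_def by (intro open_Int open_Collect_less cont\<tau> continuous_on_const)
  have "continuous_on N0 h"
    unfolding h_def
    by (intro continuous_intros cont\<tau> continuous_on_matrix_mult) (auto simp: N0_def)
  then have openN: "open (N0 \<inter> h -` G')"
    using openN0 openG' by (rule continuous_open_preimage)
  have A\<pi>: "?A ** max_mixed ** ?A = real_diag d"
  proof -
    have "a i * (1 / ?m) * a i = d i" for i
      using a2[of i] by (simp add: power2_eq_square)
    then show ?thesis unfolding max_mixed_eq real_diag_mult by simp
  qed
  have "\<tau> max_mixed = 1" by (simp add: \<tau>_def A\<pi> sum)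
  then have "max_mixed \<in> N0 \<inter> h -` G'"
    using t G(2) by (simp add: N0_def h_def A\<pi> G'_def U(2))
  from state_prob_concentration[OF openN this] obtain n0 where n0: "\<And>n M. n \<ge> n0 \<Longrightarrow> n \<ge> 1 \<Longrightarrow>
    unitarily_invariant_prob (joint_index n) M \<Longrightarrow> 1 / 2 \<le> state_prob M n (N0 \<inter> h -` G')" by blast
  have "(scaled_det \<rho> / t ^ CARD('m)) ^ n / 2 \<le> state_prob M n G"
    if n: "n \<ge> n0" "n \<ge> 1" and M: "unitarily_invariant_prob (joint_index n) M" for n M
  proof -
    have "1 / 2 * scaled_det \<rho> ^ n \<le> state_prob M n (N0 \<inter> h -` G') * scaled_det \<rho> ^ n"
      using n0[OF n M] \<rho>(2) by (intro mult_right_mono) auto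
    also have "\<dots> = state_prob M n (N0 \<inter> h -` G') * (\<Prod>i\<in>UNIV. (a i)\<^sup>2) ^ n"
      by (simp add: sd a2)
    also have "\<dots> \<le> (t ^ CARD('m)) ^ n * state_prob M n G'"
      using t by (intro state_prob_scale[OF M n(2) openN openG' a]) (auto simp: N0_def h_def \<tau>_def)
    also have "state_prob M n G' = state_prob M n G"
      unfolding G'_def by (rule state_prob_unitary[OF M G(1) U(1)])
    finally show ?thesis using t by (simp add: power_divide field_simps)
  qed
  then show ?thesis by blast
qed

subsection \<open>The large deviation principle\<close>

lemma scaled_rel_entropy:
  fixes \<rho> :: "complex^'m^'m"
  assumes "\<rho> \<in> density_ops"
  shows "ereal (real CARD('m)) * rel_entropy max_mixed \<rho> =
    (if scaled_det \<rho> > 0 then ereal (- ln (scaled_det \<rho>)) else \<infinity>)"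
proof -
  let ?m = "real CARD('m)"
  have m: "?m > 0" by simp
  have pos: "scaled_det \<rho> > 0 \<longleftrightarrow> Re (det \<rho>) > 0"
    by (simp add: scaled_det_def zero_less_mult_iff)
  have "?m * (- ln ?m - ln (Re (det \<rho>)) / ?m) = - ln (scaled_det \<rho>)" if "Re (det \<rho>) > 0"
    unfolding scaled_det_def using that m by (simp add: ln_mult ln_realpow algebra_simps)
  then show ?thesis
    using m by (simp add: rel_entropy_max_mixed[OF assms] pos)
qed

lemma limsup_log_rate_le:
  fixes \<mu> :: "nat \<Rightarrow> ('m::finite \<times> nat \<Rightarrow> complex) measure" and \<Omega> :: "(complex^'m^'m) set"
  assumes \<mu>: "\<And>n. n \<ge> 1 \<Longrightarrow> unitarily_invariant_prob (joint_index n) (\<mu> n)"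
    and K: "compact K" "K \<subseteq> density_ops" "\<Omega> \<subseteq> K"
    and x: "x > 0" "\<And>\<rho>. \<rho> \<in> K \<Longrightarrow> scaled_det \<rho> < x"
  shows "limsup (log_rate \<mu> \<Omega>) \<le> ereal (ln x)"
proof -
  obtain W C where W: "open W" "K \<subseteq> W"
    and W_le: "\<And>n M. n \<ge> 1 \<Longrightarrow> unitarily_invariant_prob (joint_index n) M \<Longrightarrow> state_prob M n W \<le> real C * x ^ n"
    using state_prob_compact_upper[OF K(1,2) x(2)] by blast
  have le: "log_rate \<mu> \<Omega> n \<le> ereal (ln (real (Suc C)) / real n + ln x)" if n: "n \<ge> 1" for n
  proof -
    interpret prob_space "\<mu> n" using \<mu>[OF n] by (simp add: unitarily_invariant_prob_def)
    define p where "p = measure (\<mu> n) {\<psi> \<in> space (\<mu> n). reduced_state n \<psi> \<in> \<Omega>}"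
    have "p \<le> state_prob (\<mu> n) n W"
      unfolding p_def state_prob_def
      using K(3) W sets_state_event[OF W(1)] unitarily_invariant_probD(2,3)[OF \<mu>[OF n]]
      by (intro finite_measure_mono) (auto simp: state_event_def)
    also have "\<dots> \<le> real C * x ^ n" by (rule W_le[OF n \<mu>[OF n]])
    \<comment> \<open>\<open>C\<close> may be 0 (empty cover); \<open>Suc C\<close> has a logarithm,
      which vanishes after division by n.\<close>
    also have "\<dots> \<le> real (Suc C) * x ^ n" using x(1) by (intro mult_right_mono) auto
    finally have p: "p \<le> real (Suc C) * x ^ n" .
    show ?thesis
    proof (cases "p = 0")
      \<comment> \<open>Here \<open>eln p\<close> is -\<infinity> and 1 / n is positive, so the rate
        is -\<infinity>.\<close>
      case True
      then show ?thesis using n by (simp add: log_rate_def eln_def p_def)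
    next
      case False
      then have "p > 0" by (simp add: p_def order_less_le)
      then have "ln p \<le> ln (real (Suc C) * x ^ n)" using p by (simp only: ln_le_cancel_iff)
      also have "\<dots> = ln (real (Suc C)) + real n * ln x" using x(1) by (simp add: ln_mult ln_realpow)
      finally have "ln p / real n \<le> ln (real (Suc C)) / real n + ln x" using n by (simp add: field_simps)
      then show ?thesis using False by (simp add: log_rate_def eln_def p_def[symmetric])
    qed
  qed
  have lim: "(\<lambda>n. ereal (ln (real (Suc C)) / real n + ln x)) \<longlonglongrightarrow> ereal (0 + ln x)"
    by (intro tendsto_intros lim_const_over_n)
  have "limsup (log_rate \<mu> \<Omega>) \<le> limsup (\<lambda>n. ereal (ln (real (Suc C)) / real n + ln x))"
    using le by (intro Limsup_mono eventually_sequentiallyI[of 1])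
  also have "\<dots> = ereal (ln x)"
    using lim_imp_Limsup[OF _ lim] by simp
  finally show ?thesis .
qed

text \<open>Each t > 1 gives a lower bound on the rate that falls short by m * ln t; the factor 1/2
  from concentration contributes only ln 2 / n. Letting t tend to 1 comes last, after the limit in
  n.\<close>

lemma liminf_log_rate_ge:
  fixes \<mu> :: "nat \<Rightarrow> ('m::finite \<times> nat \<Rightarrow> complex) measure" and \<Omega> :: "(complex^'m^'m) set"
  assumes \<mu>: "\<And>n. n \<ge> 1 \<Longrightarrow> unitarily_invariant_prob (joint_index n) (\<mu> n)"
    and \<Omega>: "\<And>n. n \<ge> 1 \<Longrightarrow> {\<psi> \<in> space (\<mu> n). reduced_state n \<psi> \<in> \<Omega>} \<in> sets (\<mu> n)"
    and G: "open G" "density_ops \<inter> G \<subseteq> \<Omega>" and \<rho>: "\<rho> \<in> density_ops" "\<rho> \<in> G" "scaled_det \<rho> > 0"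
  shows "ereal (ln (scaled_det \<rho>)) \<le> liminf (log_rate \<mu> \<Omega>)"
proof -
  let ?m = "real CARD('m)"
  have ge: "ereal (ln (scaled_det \<rho>) - ?m * ln t) \<le> liminf (log_rate \<mu> \<Omega>)" if t: "t > 1" for t
  proof -
    obtain n0 where n0: "\<And>n M. n \<ge> n0 \<Longrightarrow> n \<ge> 1 \<Longrightarrow> unitarily_invariant_prob (joint_index n) M \<Longrightarrow>
        (scaled_det \<rho> / t ^ CARD('m)) ^ n / 2 \<le> state_prob M n G"
      using state_prob_local_lower[OF \<rho>(1,3) G(1) \<rho>(2) t] by blast
    define q where "q = scaled_det \<rho> / t ^ CARD('m)"
    have q: "q > 0" using \<rho>(3) t by (simp add: q_def)
    have lnq: "ln q = ln (scaled_det \<rho>) - ?m * ln t"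
      using \<rho>(3) t by (simp add: q_def ln_div ln_realpow)
    have le: "ereal (ln q - ln 2 / real n) \<le> log_rate \<mu> \<Omega> n" if n: "n \<ge> max n0 1" for n
    proof -
      have n1: "n \<ge> 1" using n by simp
      interpret prob_space "\<mu> n" using \<mu>[OF n1] by (simp add: unitarily_invariant_prob_def)
      define p where "p = measure (\<mu> n) {\<psi> \<in> space (\<mu> n). reduced_state n \<psi> \<in> \<Omega>}"
      have "q ^ n / 2 \<le> state_prob (\<mu> n) n G" unfolding q_def using n by (intro n0 \<mu>) auto
      also have "\<dots> \<le> p"
        unfolding p_def state_prob_def
        using G(2) reduced_state_density unitarily_invariant_probD(3)[OF \<mu>[OF n1]]
        by (intro finite_measure_mono \<Omega> n1) (auto simp: state_event_def)
      finally have p: "q ^ n / 2 \<le> p" .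
      have "q ^ n / 2 > 0" using q by simp
      then have "p > 0" using p by linarith
      then have "ln (q ^ n / 2) \<le> ln p" using p \<open>q ^ n / 2 > 0\<close> by (simp only: ln_le_cancel_iff)
      moreover have "ln (q ^ n / 2) = real n * ln q - ln 2" using q by (simp add: ln_div ln_realpow)
      ultimately have "(real n * ln q - ln 2) / real n \<le> ln p / real n"
        by (intro divide_right_mono) auto
      then have "ln q - ln 2 / real n \<le> ln p / real n" using n1 by (simp add: diff_divide_distrib)
      then show ?thesis using \<open>p > 0\<close> by (simp add: log_rate_def eln_def p_def[symmetric])
    qed
    have lim: "(\<lambda>n. ereal (ln q - ln 2 / real n)) \<longlonglongrightarrow> ereal (ln q - 0)"
      by (intro tendsto_intros lim_const_over_n)
    have "ereal (ln q) = liminf (\<lambda>n. ereal (ln q - ln 2 / real n))"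
      using lim_imp_Liminf[OF _ lim] by simp
    also have "\<dots> \<le> liminf (log_rate \<mu> \<Omega>)"
      using le by (intro Liminf_mono eventually_sequentiallyI[of "max n0 1"])
    finally show ?thesis by (simp only: lnq)
  qed
  have "((\<lambda>t. ereal (ln (scaled_det \<rho>) - ?m * ln t)) \<longlongrightarrow> ereal (ln (scaled_det \<rho>) - ?m * ln 1)) (at_right 1)"
    by (intro tendsto_intros) auto
  moreover have "eventually (\<lambda>t. ereal (ln (scaled_det \<rho>) - ?m * ln t) \<le> liminf (log_rate \<mu> \<Omega>)) (at_right 1)"
    using eventually_at_right_less[of "1::real"] by eventually_elim (rule ge)
  ultimately have "ereal (ln (scaled_det \<rho>) - ?m * ln 1) \<le> liminf (log_rate \<mu> \<Omega>)"
    by (rule tendsto_upperbound) simp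
  then show ?thesis by simp
qed

lemma topspace_state_topology [simp]: "topspace state_topology = density_ops"
  by (simp add: state_topology_eq)

text \<open>Upper semicontinuity: the states with m D < r are those with \<open>scaled_det\<close>
  above exp(- r), a relatively open set. If it contains a point of the closure of S, it meets
  S.\<close>

lemma INF_rel_entropy_le_closure:
  fixes S :: "(complex^'m^'m) set"
  assumes S: "S \<subseteq> density_ops" and \<rho>: "\<rho> \<in> state_topology closure_of S"
  shows "(INF \<sigma>\<in>S. ereal (real CARD('m)) * rel_entropy max_mixed \<sigma>) \<le> ereal (real CARD('m)) * rel_entropy max_mixed \<rho>"
    (is "?inf \<le> ?D \<rho>")
proof (rule ccontr)
  assume "\<not> ?thesis"
  then have lt: "?D \<rho> < ?inf" by simp
  then obtain r where r: "?D \<rho> < ereal r" "ereal r < ?inf" using ereal_dense2 by blast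
  have \<rho>d: "\<rho> \<in> density_ops" using \<rho> closure_of_subset_topspace[of state_topology S] by auto
  have iff: "?D \<sigma> < ereal r \<longleftrightarrow> exp (- r) < scaled_det \<sigma>" if "\<sigma> \<in> density_ops" for \<sigma>
  proof (cases "scaled_det \<sigma> > 0")
    case True
    have "- ln (scaled_det \<sigma>) < r \<longleftrightarrow> - r < ln (scaled_det \<sigma>)" by linarith
    also have "\<dots> \<longleftrightarrow> exp (- r) < exp (ln (scaled_det \<sigma>))" by (simp only: exp_less_cancel_iff)
    also have "\<dots> \<longleftrightarrow> exp (- r) < scaled_det \<sigma>" using True by (simp only: exp_ln)
    finally show ?thesis using True by (simp add: scaled_rel_entropy[OF that])
  next
    case False
    then have "\<not> exp (- r) < scaled_det \<sigma>" using exp_gt_zero[of "- r"] by linarith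
    then show ?thesis using False by (simp add: scaled_rel_entropy[OF that])
  qed
  have "open {\<sigma> :: complex^'m^'m. exp (- r) < scaled_det \<sigma>}"
    by (intro open_Collect_less continuous_on_const continuous_on_scaled_det)
  then have "openin state_topology (density_ops \<inter> {\<sigma> :: complex^'m^'m. exp (- r) < scaled_det \<sigma>})"
    unfolding state_topology_eq by (rule openin_open_Int)
  moreover have "\<rho> \<in> density_ops \<inter> {\<sigma>. exp (- r) < scaled_det \<sigma>}"
    using r(1) iff[OF \<rho>d] \<rho>d by simp
  moreover have "\<forall>T. \<rho> \<in> T \<and> openin state_topology T \<longrightarrow> (\<exists>\<sigma>. \<sigma> \<in> S \<and> \<sigma> \<in> T)"
    using \<rho>[unfolded in_closure_of] by (rule conjunct2)
  ultimately have "\<exists>\<sigma>. \<sigma> \<in> S \<and> \<sigma> \<in> density_ops \<inter> {\<sigma>. exp (- r) < scaled_det \<sigma>}"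
    by metis
  then obtain \<sigma> where \<sigma>: "\<sigma> \<in> S" "exp (- r) < scaled_det \<sigma>"
    by auto
  then have "?D \<sigma> < ereal r" using iff[of \<sigma>] S by blast
  then show False using r(2) INF_lower[OF \<sigma>(1), of ?D] by (meson less_le_trans less_asym)
qed

theorem theorem1:
  fixes \<mu> :: "nat \<Rightarrow> ('m::finite \<times> nat \<Rightarrow> complex) measure"
    and \<Omega> :: "(complex^'m^'m) set"
  assumes "\<And>n. n \<ge> 1 \<Longrightarrow> unitarily_invariant_prob (UNIV \<times> {..<n}) (\<mu> n)"
    and "\<Omega> \<subseteq> density_ops"
    and "\<And>n. n \<ge> 1 \<Longrightarrow> {\<psi> \<in> space (\<mu> n). reduced_state n \<psi> \<in> \<Omega>} \<in> sets (\<mu> n)"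
  shows "- limsup (log_rate \<mu> \<Omega>)
           \<ge> ereal (real CARD('m)) * (INF \<rho>\<in>state_topology closure_of \<Omega>. rel_entropy max_mixed \<rho>)
       \<and> - liminf (log_rate \<mu> \<Omega>)
           \<le> ereal (real CARD('m)) * (INF \<rho>\<in>state_topology interior_of \<Omega>. rel_entropy max_mixed \<rho>)
       \<and> (state_topology closure_of (state_topology interior_of \<Omega>) = state_topology closure_of \<Omega> \<longrightarrow>
           convergent (log_rate \<mu> \<Omega>) \<and>
           - lim (log_rate \<mu> \<Omega>) = ereal (real CARD('m)) * (INF \<rho>\<in>\<Omega>. rel_entropy max_mixed \<rho>))"
proof -
  let ?D = "\<lambda>\<rho> :: complex^'m^'m. ereal (real CARD('m)) * rel_entropy max_mixed \<rho>"
  let ?cl = "state_topology closure_of \<Omega>" and ?int = "state_topology interior_of \<Omega>"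
  have m: "real CARD('m) > 0" by simp
  \<comment> \<open>Since m is positive, the factor passes through the infimum, also for the empty
    set, where both sides are \<infinity>.\<close>
  have INF: "ereal (real CARD('m)) * (INF \<rho>\<in>S. rel_entropy max_mixed \<rho>) = (INF \<rho>\<in>S. ?D \<rho>)" for S :: "(complex^'m^'m) set"
    using ereal_Inf_cmult[OF m, of "\<lambda>x. x \<in> rel_entropy max_mixed ` S"]
    by (simp add: image_image setcompr_eq_image)
  have cl: "?cl \<subseteq> density_ops" "\<Omega> \<subseteq> ?cl" "?int \<subseteq> \<Omega>"
    using closure_of_subset_topspace[of state_topology \<Omega>] closure_of_subset[of \<Omega> state_topology] assms(2)
      interior_of_subset[of state_topology \<Omega>] by auto
  have compact: "compact ?cl"
  proof -
    have "closedin (top_of_set density_ops) ?cl"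
      unfolding state_topology_eq by (rule closedin_closure_of)
    then show ?thesis using compact_density_ops closedin_compact by blast
  qed
  \<comment> \<open>A real r strictly between the two sides makes \<open>scaled_det\<close> smaller
    than exp(- r) on the whole compact closure, which is the uniform bound that the covering
    argument needs. This covers an infinite infimum as well.\<close>
  have upper: "(INF \<rho>\<in>?cl. ?D \<rho>) \<le> - limsup (log_rate \<mu> \<Omega>)"
  proof (rule ccontr)
    assume "\<not> ?thesis"
    then obtain r where r: "- limsup (log_rate \<mu> \<Omega>) < ereal r" "ereal r < (INF \<rho>\<in>?cl. ?D \<rho>)"
      using ereal_dense2 by (meson not_le)
    have "scaled_det \<rho> < exp (- r)" if "\<rho> \<in> ?cl" for \<rho>
    proof (cases "scaled_det \<rho> > 0")
      case True
      have "ereal r < ?D \<rho>" using r(2) INF_lower[OF that, of ?D] by (rule less_le_trans)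
      then have "ln (scaled_det \<rho>) < - r" using True that cl(1) scaled_rel_entropy[of \<rho>] by auto
      then have "exp (ln (scaled_det \<rho>)) < exp (- r)" by (simp only: exp_less_cancel_iff)
      then show ?thesis using True by (simp only: exp_ln)
    next
      case False
      then show ?thesis using exp_gt_zero[of "- r"] by linarith
    qed
    then have "limsup (log_rate \<mu> \<Omega>) \<le> ereal (ln (exp (- r)))"
      by (intro limsup_log_rate_le[OF assms(1) compact cl(1,2)]) auto
    then have "limsup (log_rate \<mu> \<Omega>) \<le> - ereal r" by simp
    then have "- (- ereal r) \<le> - limsup (log_rate \<mu> \<Omega>)" by (simp only: ereal_minus_le_minus)
    then show False using r(1) by simp
  qed
  \<comment> \<open>Each interior state is treated on its own; for singular ones the right-hand side
    is \<infinity>.\<close>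
  have lower: "- liminf (log_rate \<mu> \<Omega>) \<le> (INF \<rho>\<in>?int. ?D \<rho>)"
  proof (rule INF_greatest)
    fix \<rho> assume \<rho>: "\<rho> \<in> ?int"
    then have \<rho>d: "\<rho> \<in> density_ops" using cl by auto
    show "- liminf (log_rate \<mu> \<Omega>) \<le> ?D \<rho>"
    proof (cases "scaled_det \<rho> > 0")
      case True
      have "openin (top_of_set density_ops) ?int"
        unfolding state_topology_eq by (rule openin_interior_of)
      then obtain G where G: "open G" "?int = density_ops \<inter> G"
        unfolding openin_open by blast
      have "ereal (ln (scaled_det \<rho>)) \<le> liminf (log_rate \<mu> \<Omega>)"
        using G \<rho> \<rho>d cl(3) True by (intro liminf_log_rate_ge[OF assms(1) assms(3) G(1)]) auto
      then have "- liminf (log_rate \<mu> \<Omega>) \<le> - ereal (ln (scaled_det \<rho>))"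
        by (simp only: ereal_minus_le_minus)
      then show ?thesis using True by (simp add: scaled_rel_entropy[OF \<rho>d])
    qed (simp add: scaled_rel_entropy[OF \<rho>d])
  qed
  have "convergent (log_rate \<mu> \<Omega>) \<and> - lim (log_rate \<mu> \<Omega>) = (INF \<rho>\<in>\<Omega>. ?D \<rho>)"
    if eq: "state_topology closure_of ?int = ?cl"
  proof -
    \<comment> \<open>The only use of the regularity of \<open>\<Omega>\<close>: every point of its
      closure is a limit of interior points. It closes the chain of inequalities, so limsup and
      liminf coincide.\<close>
    have "(INF \<rho>\<in>?int. ?D \<rho>) \<le> (INF \<rho>\<in>?cl. ?D \<rho>)"
      using cl eq by (intro INF_greatest INF_rel_entropy_le_closure) auto
    moreover have "(INF \<rho>\<in>?cl. ?D \<rho>) \<le> (INF \<rho>\<in>\<Omega>. ?D \<rho>)" "(INF \<rho>\<in>\<Omega>. ?D \<rho>) \<le> (INF \<rho>\<in>?int. ?D \<rho>)"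
      using cl by (auto intro: INF_superset_mono)
    moreover have "- limsup (log_rate \<mu> \<Omega>) \<le> - liminf (log_rate \<mu> \<Omega>)"
      using Liminf_le_Limsup[of sequentially "log_rate \<mu> \<Omega>"] by simp
    ultimately have "- limsup (log_rate \<mu> \<Omega>) = (INF \<rho>\<in>\<Omega>. ?D \<rho>)" "- liminf (log_rate \<mu> \<Omega>) = (INF \<rho>\<in>\<Omega>. ?D \<rho>)"
      using upper lower by (meson antisym order_trans)+
    then have l: "limsup (log_rate \<mu> \<Omega>) = - (INF \<rho>\<in>\<Omega>. ?D \<rho>)" "liminf (log_rate \<mu> \<Omega>) = - (INF \<rho>\<in>\<Omega>. ?D \<rho>)"
      by (metis ereal_uminus_uminus)+
    have "log_rate \<mu> \<Omega> \<longlonglongrightarrow> - (INF \<rho>\<in>\<Omega>. ?D \<rho>)"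
      by (rule Liminf_eq_Limsup[OF _ l(2,1)]) simp
    then show ?thesis using limI[of "log_rate \<mu> \<Omega>"] by (auto simp: convergent_def)
  qed
  then show ?thesis using upper lower unfolding INF by blast
qed

end
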